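(* Let $k,n\ge2$, and let $Y\subset\mathrm{Gr}(n,k+n)$ be a smooth Fano complete intersection of hypersurfaces of degrees $d_1,\dots,d_l$, with $d_0=k+n-\sum_{i=1}^l d_i>0$. Let $f_Y$ be the Laurent polynomial in $nk-l$ variables constructed from $(k,n;d_1,\dots,d_l)$ as described in the context. Then the period condition holds for $f_Y$, i.e. the constant terms series of $f_Y$ equals the constant term $\widetilde I^Y_0(t)$ of the regularized $I$-series of $Y$ in the anticanonical direction, as given by $$\sum_{i\ge0}[f_Y^i]_0\,t^i=\widetilde I_0^Y(t)=\sum_{d\ge0}\ \sum_{s_{i,j}\ge0}\frac{\prod_{i=0}^l(d_id)!}{(d!)^{k+n}}\prod_{i=1}^{k-1}\prod_{j=1}^{n-1}\binom{s_{i+1,j}}{s_{i,j}}\binom{s_{i,j+1}}{s_{i,j}}\,t^{d_0d},$$ where the inner sum is over non-negative integers $s_{i,j}$, $i\in[1,k-1]$, $j\in[1,n-1]$, and $s_{k,j}=s_{i,n}=d$. In other words, $f_Y$ is a weak Landau--Ginzburg model of $Y$.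
   Context: Here $[g]_0$ denotes the constant term of a Laurent polynomial $g$, and $[p,q]=\{i\in\mathbb Z\mid p\le i\le q\}$. A weak Landau--Ginzburg model of $Y$ is a Laurent polynomial in $\dim Y$ variables whose constant terms series $\sum_i[f^i]_0t^i$ equals $\widetilde I^Y_0(t)$. Quiver. Let $\mathcal Q$ have vertices $\{(i,j)\mid i\in[1,k],\,j\in[1,n]\}\cup\{(0,1),(k,n+1)\}$ and the following arrows: vertical arrows $(i,j)\to(i+1,j)$ for $i\in[1,k-1]$, $j\in[1,n]$, and $(0,1)\to(1,1)$; horizontal arrows $(i,j)\to(i,j+1)$ for $i\in[1,k]$, $j\in[1,n-1]$, and $(k,n)\to(k,n+1)$. For an arrow $\alpha$ let $t(\alpha)$ and $h(\alpha)$ be its tail and head. Blocks. For $q\in[1,k]$ let $E_q$ be the set of all vertical arrows from row $q-1$ to row $q$ (arrows $(q-1,j)\to(q,j)$), and for $j\in[1,n]$ let $E_{k+j}$ be the set of all horizontal arrows from column $j$ to column $j+1$ (arrows $(i,j)\to(i,j+1)$). Put $u_0=0$, $u_p=d_1+\dots+d_p$, and $B_p=\bigcup_{q=u_{p-1}+1}^{u_p}E_q$ for $p\in[1,l]$ (these are the consecutive blocks of sizes $d_1,\dots,d_l$). Let $B_0$ be the set of all remaining arrows, and let $A=B_0\setminus\{(k,n)\to(k,n+1)\}$. Variables. Take variables $a$ and $a_{i,j}$, $i\in[1,k]$, $j\in[1,n]$, $(i,j)\ne(k,n)$, and put $a_{k,n}=1$, $a_{0,1}=a_{k,n+1}=a$.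 For a set $S$ of arrows put $F_S=\sum_{\alpha\in S}a_{h(\alpha)}/a_{t(\alpha)}$. The weight vertex of $B_p$ is $(u_p-1,1)$ if $u_p\le k$, and $(k,u_p-k)$ if $u_p>k$; the weight variable of $B_p$ is the variable $a_{i,j}$ indexed by its weight vertex $(i,j)$, with $a_{0,1}=a$. The $l$ weight variables are pairwise distinct. Laurent polynomial. For a Laurent polynomial $g$ in the $nk$ variables $a$ and $a_{i,j}$ ($i\in[1,k]$, $j\in[1,n]$, $(i,j)\ne(k,n)$), let $\overline g$ be the result of setting all $l$ weight variables equal to $1$. Then $$f_Y=\overline{F_A}+\overline a\cdot\prod_{p=1}^l\bigl(\overline{F_{B_p}}\bigr)^{d_p},$$ a Laurent polynomial in the remaining $nk-l=\dim Y$ variables. (It is the pull-back of the function $F_{B_0}$, the superpotential of the Batyrev--Ciocan-Fontanine--Kim--van Straten Landau--Ginzburg model $\{F_{B_1}=\dots=F_{B_l}=1\}$, under a birational map from the torus $(\mathbb C^* )^{nk-l}$ to this subvariety.) *)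

theory Defs
  imports
    "HOL-Library.Poly_Mapping"
    "HOL-Library.FuncSet"
    "HOL-Computational_Algebra.Formal_Power_Series"
    "HOL-Analysis.Infinite_Sum"
begin

text \<open>
  Laurent polynomials over \<open>\<complex>\<close> are the group algebra of the free abelian group of exponent vectors:
  finitely supported functions from exponents to coefficients, with the convolution product.
\<close>

type_synonym 'v expo = "'v \<Rightarrow>\<^sub>0 int"
type_synonym 'v laurent = "'v expo \<Rightarrow>\<^sub>0 complex"

definition constant_term :: "'v laurent \<Rightarrow> complex" where
  "constant_term g = Poly_Mapping.lookup g 0"

definition constant_terms_series :: "'v laurent \<Rightarrow> complex fps" where
  "constant_terms_series g = Abs_fps (\<lambda>m. constant_term (g ^ m))"

definition laurent_in :: "'v set \<Rightarrow> 'v laurent \<Rightarrow> bool" where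
  "laurent_in V g \<longleftrightarrow> (\<forall>e\<in>Poly_Mapping.keys g. Poly_Mapping.keys e \<subseteq> V)"

definition weak_LG_model :: "'v set \<Rightarrow> nat \<Rightarrow> complex fps \<Rightarrow> 'v laurent \<Rightarrow> bool" where
  "weak_LG_model V N I f \<longleftrightarrow>
     finite V \<and> card V = N \<and> laurent_in V f \<and> constant_terms_series f = I"

definition set_to_one_expo :: "'v set \<Rightarrow> 'v expo \<Rightarrow> 'v expo" where
  "set_to_one_expo W e = Poly_Mapping.mapp (\<lambda>v c. if v \<in> W then 0 else c) e"

definition set_to_one :: "'v set \<Rightarrow> 'v laurent \<Rightarrow> 'v laurent" where
  "set_to_one W g =
     (\<Sum>e\<in>Poly_Mapping.keys g.
        Poly_Mapping.single (set_to_one_expo W e) (Poly_Mapping.lookup g e))"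


type_synonym vertex = "nat \<times> nat"
type_synonym arrow = "vertex \<times> vertex"

text \<open>An arrow is the pair (tail, head); the quiver has no multiple arrows.\<close>

abbreviation tail :: "arrow \<Rightarrow> vertex" where "tail \<equiv> fst"
abbreviation head :: "arrow \<Rightarrow> vertex" where "head \<equiv> snd"

definition vertical_arrows :: "nat \<Rightarrow> nat \<Rightarrow> arrow set" where
  "vertical_arrows k n =
     {((i, j), (i + 1, j)) | i j. i \<in> {1..k-1} \<and> j \<in> {1..n}} \<union> {((0, 1), (1, 1))}"

definition horizontal_arrows :: "nat \<Rightarrow> nat \<Rightarrow> arrow set" where
  "horizontal_arrows k n =
     {((i, j), (i, j + 1)) | i j. i \<in> {1..k} \<and> j \<in> {1..n-1}} \<union> {((k, n), (k, n + 1))}"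

definition arrows :: "nat \<Rightarrow> nat \<Rightarrow> arrow set" where
  "arrows k n = vertical_arrows k n \<union> horizontal_arrows k n"

text \<open>
  For \<open>q \<le> k\<close> the arrows from row \<open>q - 1\<close> to row \<open>q\<close>; for \<open>q = k + j\<close> the arrows from column \<open>j\<close>
  to column \<open>j + 1\<close>.
\<close>

definition E_set :: "nat \<Rightarrow> nat \<Rightarrow> nat \<Rightarrow> arrow set" where
  "E_set k n q =
     (if q \<le> k then {\<alpha> \<in> vertical_arrows k n. fst (head \<alpha>) = q}
      else {\<alpha> \<in> horizontal_arrows k n. snd (tail \<alpha>) = q - k})"

definition u_sum :: "(nat \<Rightarrow> nat) \<Rightarrow> nat \<Rightarrow> nat" where
  "u_sum d p = (\<Sum>q=1..p. d q)"

text \<open>Block \<open>B\<^sub>p\<close> for \<open>1 \<le> p \<le> l\<close>.\<close>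

definition block :: "nat \<Rightarrow> nat \<Rightarrow> (nat \<Rightarrow> nat) \<Rightarrow> nat \<Rightarrow> arrow set" where
  "block k n d p = (\<Union>q\<in>{u_sum d (p - 1) + 1..u_sum d p}. E_set k n q)"

definition block0 :: "nat \<Rightarrow> nat \<Rightarrow> nat \<Rightarrow> (nat \<Rightarrow> nat) \<Rightarrow> arrow set" where
  "block0 k n l d = arrows k n - (\<Union>p\<in>{1..l}. block k n d p)"

definition A_set :: "nat \<Rightarrow> nat \<Rightarrow> nat \<Rightarrow> (nat \<Rightarrow> nat) \<Rightarrow> arrow set" where
  "A_set k n l d = block0 k n l d - {((k, n), (k, n + 1))}"

text \<open>
  The variable \<open>a\<^sub>i\<^sub>,\<^sub>j\<close> is indexed by \<open>(i, j)\<close> and the variable \<open>a\<close> by \<open>(0, 1)\<close>.  \<open>vertex_expo\<close> is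
  the exponent vector of the monomial attached to a vertex, so that the vertex \<open>(k, n)\<close> carries
  \<open>1\<close> and both \<open>(0, 1)\<close> and \<open>(k, n + 1)\<close> carry \<open>a\<close>.
\<close>

definition variables :: "nat \<Rightarrow> nat \<Rightarrow> vertex set" where
  "variables k n = insert (0, 1) ({1..k} \<times> {1..n} - {(k, n)})"

definition vertex_expo :: "nat \<Rightarrow> nat \<Rightarrow> vertex \<Rightarrow> vertex expo" where
  "vertex_expo k n v =
     (if v = (k, n) then 0
      else if v = (k, n + 1) then Poly_Mapping.single (0, 1) 1
      else Poly_Mapping.single v 1)"

definition a_var :: "vertex laurent" where
  "a_var = Poly_Mapping.single (Poly_Mapping.single (0, 1) 1) 1"

text \<open>The quotient of the monomials at head and tail is the monomial of the exponent difference.\<close>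

definition F_sum :: "nat \<Rightarrow> nat \<Rightarrow> arrow set \<Rightarrow> vertex laurent" where
  "F_sum k n S =
     (\<Sum>\<alpha>\<in>S. Poly_Mapping.single (vertex_expo k n (head \<alpha>) - vertex_expo k n (tail \<alpha>)) 1)"

definition weight_vertex :: "nat \<Rightarrow> (nat \<Rightarrow> nat) \<Rightarrow> nat \<Rightarrow> vertex" where
  "weight_vertex k d p = (if u_sum d p \<le> k then (u_sum d p - 1, 1) else (k, u_sum d p - k))"

definition weight_variables :: "nat \<Rightarrow> nat \<Rightarrow> (nat \<Rightarrow> nat) \<Rightarrow> vertex set" where
  "weight_variables k l d = weight_vertex k d ` {1..l}"

definition f_Y :: "nat \<Rightarrow> nat \<Rightarrow> nat \<Rightarrow> (nat \<Rightarrow> nat) \<Rightarrow> vertex laurent" where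
  "f_Y k n l d =
     (let bar = set_to_one (weight_variables k l d) in
      bar (F_sum k n (A_set k n l d)) +
      bar a_var * (\<Prod>p=1..l. bar (F_sum k n (block k n d p)) ^ d p))"


text \<open>
  The constant term of the regularized I-series of a smooth Fano complete intersection of degrees
  \<open>d 1, \<dots>, d l\<close> in \<open>Gr(n, k + n)\<close>, with \<open>d 0 = k + n - (d 1 + \<dots> + d l) > 0\<close>, in the anticanonical
  direction.  It depends on the complete intersection only through these numbers.  The variable
  \<open>e\<close> is the summation index over curve degrees; since \<open>d 0 > 0\<close>, at most one \<open>e\<close> contributes to each
  power of \<open>t\<close>.  The inner sum ranges over an infinite set but has finite support, because a
  non-zero summand forces every \<open>s (i, j) \<le> e\<close>.
\<close>

definition s_ext :: "nat \<Rightarrow> nat \<Rightarrow> nat \<Rightarrow> (nat \<times> nat \<Rightarrow> nat) \<Rightarrow> nat \<Rightarrow> nat \<Rightarrow> nat" where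
  "s_ext k n e s i j = (if i = k \<or> j = n then e else s (i, j))"

definition I_coeff :: "nat \<Rightarrow> nat \<Rightarrow> nat \<Rightarrow> (nat \<Rightarrow> nat) \<Rightarrow> nat \<Rightarrow> complex" where
  "I_coeff k n l d e =
     (\<Sum>\<^sub>\<infinity>s \<in> ({1..k-1} \<times> {1..n-1}) \<rightarrow>\<^sub>E (UNIV :: nat set).
        (\<Prod>i=0..l. fact (d i * e)) / fact e ^ (k + n) *
        (\<Prod>i=1..k-1. \<Prod>j=1..n-1.
           of_nat (s_ext k n e s (i + 1) j choose s_ext k n e s i j) *
           of_nat (s_ext k n e s i (j + 1) choose s_ext k n e s i j)))"

definition I_series :: "nat \<Rightarrow> nat \<Rightarrow> nat \<Rightarrow> (nat \<Rightarrow> nat) \<Rightarrow> complex fps" where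
  "I_series k n l d = Abs_fps (\<lambda>m. \<Sum>e | d 0 * e = m. I_coeff k n l d e)"

end

theory Submission
  imports Defs
begin

text \<open>
  The power \<open>f_Y ^ m\<close> is expanded completely: the summand
  \<open>a * (\<Prod>p. F\<^sub>p ^ d p)\<close>, where \<open>F\<^sub>p\<close> belongs to the block \<open>B\<^sub>p\<close>, is chosen \<open>r\<close> times, and all sums
  over arrows are expanded multinomially.  The terms are indexed by \<open>r\<close> and by counts \<open>c\<close> that record how
  often each arrow other than the last is used.  The total over \<open>B\<^sub>p\<close> is \<open>d p * r\<close> and the total
  over \<open>A\<close> is \<open>m - r\<close>.  A term contributes to the constant term iff the product of \<open>a\<^sup>r\<close> and of the
  arrow monomials becomes \<open>1\<close> after the weight variables are set to \<open>1\<close>.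

  Setting the weight variables to \<open>1\<close> loses no information.  Each block defines a grading of monomials,
  the number of arrows of the block on a path from the source (normalised to be \<open>0\<close> at \<open>(k, n)\<close>).
  All terms of the expansion have degree \<open>0\<close>, since the degree of \<open>a\<close> is \<open>- d p\<close>, and on the weight
  variables the \<open>l\<close> gradings form a triangular matrix with diagonal \<open>-1\<close> (\<open>weight_expo_eq_zero\<close>).
  Hence a contributing monomial is trivial before the specialisation already, which says that \<open>c\<close>
  is a flow of value \<open>r\<close> from \<open>(0, 1)\<close> to \<open>(k, n)\<close>.  Such a flow passes \<open>r\<close> times through each of the
  sets \<open>E_set k n q\<close>, \<open>1 \<le> q < k + n\<close>, so the totals over the blocks come for free and \<open>m = d 0 * r\<close>
  (\<open>reduced_balance_iff_flow\<close>).  The multinomial coefficients multiply to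
  \<open>(\<Prod>i=0..l. fact (d i * r)) / (fact r * (\<Prod>\<alpha>. fact (c \<alpha>)))\<close>.

  It remains to sum \<open>1 / (\<Prod>\<alpha>. fact (c \<alpha>))\<close> over all flows of value \<open>r\<close>.  The quiver is planar, so a
  flow is the same as a height function on the faces that is monotone in both directions, and each
  arrow carries the height difference across it (\<open>flow_through_corner\<close>, \<open>grid_sum_by_parts\<close>).  The
  heights are the entries \<open>s\<^sub>i\<^sub>,\<^sub>j\<close> of the \<open>I\<close>-series.  Along each row and each column the binomial
  coefficients multiply to a multinomial coefficient whose denominator consists of the factorials of the
  height differences (\<open>table_weight\<close>), which identifies the two sums (\<open>I_coeff_eq_sum_flows\<close>).
\<close>

section \<open>Multinomial expansion of sums of Laurent monomials\<close>

text \<open>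
  The index set of a product of multinomial expansions, one for each of the sets \<open>B p\<close>.  A count is a
  total function that vanishes off the union of these sets, so that counts can be added and
  restricted pointwise.
\<close>
definition exponent_counts :: "'i set \<Rightarrow> ('i \<Rightarrow> 'a set) \<Rightarrow> ('i \<Rightarrow> nat) \<Rightarrow> ('a \<Rightarrow> nat) set" where
  "exponent_counts P B N =
     {c. (\<forall>\<alpha>. \<alpha> \<notin> \<Union> (B ` P) \<longrightarrow> c \<alpha> = 0) \<and> (\<forall>p\<in>P. sum c (B p) = N p)}"

lemma finite_exponent_counts:
  assumes "finite P" and "\<And>p. p \<in> P \<Longrightarrow> finite (B p)"
  shows "finite (exponent_counts P B N)"
proof (rule finite_subset)
  let ?S = "\<Union> (B ` P)"
  show "exponent_counts P B N \<subseteq> {c. \<forall>\<alpha>. (\<alpha> \<in> ?S \<longrightarrow> c \<alpha> \<in> {..Max (N ` P)}) \<and> (\<alpha> \<notin> ?S \<longrightarrow> c \<alpha> = 0)}"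
  proof (clarsimp simp: exponent_counts_def, goal_cases)
    case (1 c \<alpha> p)
    then have "c \<alpha> \<le> sum c (B p)"
      by (intro member_le_sum) (auto simp: assms)
    also have "\<dots> = N p" using 1 by auto
    also have "\<dots> \<le> Max (N ` P)" using 1 assms by auto
    finally show ?case .
  qed
  show "finite {c. \<forall>\<alpha>. (\<alpha> \<in> ?S \<longrightarrow> c \<alpha> \<in> {..Max (N ` P)}) \<and> (\<alpha> \<notin> ?S \<longrightarrow> c \<alpha> = 0)}"
    using assms by (intro finite_set_of_finite_funs) auto
qed

lemma single_power:
  fixes e :: "'v expo" and z :: "'c::comm_semiring_1"
  shows "Poly_Mapping.single e z ^ N = Poly_Mapping.single (frag_cmul (int N) e) (z ^ N)"
  by (induction N) (simp_all add: mult_single frag_cmul_distrib algebra_simps)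

lemma of_nat_mult_single:
  fixes e :: "'v expo" and z :: "'c::comm_semiring_1"
  shows "of_nat j * Poly_Mapping.single e z = Poly_Mapping.single e (of_nat j * z)"
  using mult_single[of 0 "of_nat j" e z] by simp

text \<open>
  The multinomial theorem, with the product of the monomials collected into a single exponent.
  Adjoining one summand is the binomial theorem: its multiplicity \<open>i\<close> splits off, and
  \<open>N choose i\<close> turns \<open>fact (N - i)\<close> into \<open>fact N / fact i\<close>.
\<close>
lemma multinomial_laurent:
  fixes x :: "'a \<Rightarrow> 'v expo"
  assumes "finite S"
  shows "(\<Sum>\<alpha>\<in>S. Poly_Mapping.single (x \<alpha>) (1::complex)) ^ N =
    (\<Sum>c\<in>exponent_counts {()} (\<lambda>_. S) (\<lambda>_. N).
       Poly_Mapping.single (\<Sum>\<alpha>\<in>S. frag_cmul (int (c \<alpha>)) (x \<alpha>)) (fact N / (\<Prod>\<alpha>\<in>S. fact (c \<alpha>))))"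
  using assms
proof (induction S arbitrary: N rule: finite_induct)
  case empty
  have "exponent_counts {()} (\<lambda>_. {} :: 'a set) (\<lambda>_. N) = (if N = 0 then {\<lambda>_. 0} else {})"
    by (auto simp: exponent_counts_def)
  then show ?case by (simp add: power_0_left)
next
  case (insert a S)
  define T where "T S c N = Poly_Mapping.single (\<Sum>\<alpha>\<in>S. frag_cmul (int (c \<alpha>)) (x \<alpha>))
      (fact N / (\<Prod>\<alpha>\<in>S. fact (c \<alpha>)) :: complex)" for S N and c :: "'a \<Rightarrow> nat"
  let ?C = "\<lambda>S N. exponent_counts {()} (\<lambda>_. S) (\<lambda>_. N)"
  have step: "of_nat (N choose i) * Poly_Mapping.single (x a) 1 ^ i * T S c (N - i) = T (insert a S) (c(a := i)) N"
    if "i \<le> N" for i and c :: "'a \<Rightarrow> nat"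
  proof -
    have 1: "(\<Sum>\<alpha>\<in>S. frag_cmul (int ((c(a := i)) \<alpha>)) (x \<alpha>)) = (\<Sum>\<alpha>\<in>S. frag_cmul (int (c \<alpha>)) (x \<alpha>))"
      using insert.hyps by (intro sum.cong) auto
    have 2: "(\<Prod>\<alpha>\<in>S. fact ((c(a := i)) \<alpha>)) = (\<Prod>\<alpha>\<in>S. fact (c \<alpha>) :: complex)"
      using insert.hyps by (intro prod.cong) auto
    have 3: "of_nat (N choose i) * fact (N - i) / z = fact N / (fact i * z)" for z :: complex
      using that by (simp add: binomial_fact divide_simps)
    show ?thesis
      using insert.hyps that
      by (simp add: T_def 1 2 3 single_power of_nat_mult_single mult_single del: fun_upd_apply)
         (simp add: fun_upd_apply)
  qed
  have "(\<Sum>\<alpha>\<in>insert a S. Poly_Mapping.single (x \<alpha>) (1::complex)) ^ N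
      = (\<Sum>i\<le>N. \<Sum>c\<in>?C S (N - i). of_nat (N choose i) * Poly_Mapping.single (x a) 1 ^ i * T S c (N - i))"
    using insert by (simp add: binomial_ring sum_distrib_left T_def)
  also have "\<dots> = (\<Sum>i\<le>N. \<Sum>c\<in>?C S (N - i). T (insert a S) (c(a := i)) N)"
    by (intro sum.cong) (auto simp: step)
  also have "\<dots> = (\<Sum>(i, c)\<in>Sigma {..N} (\<lambda>i. ?C S (N - i)). T (insert a S) (c(a := i)) N)"
    using insert.hyps by (intro sum.Sigma) (auto intro: finite_exponent_counts)
  also have "\<dots> = (\<Sum>c\<in>?C (insert a S) N. T (insert a S) c N)"
  proof (rule sum.reindex_bij_witness[where j = "\<lambda>(i, c). c(a := i)" and i = "\<lambda>c. (c a, c(a := 0))"])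
    fix c assume c: "c \<in> ?C (insert a S) N"
    have "sum (c(a := 0)) S = sum c S"
      using insert.hyps by (intro sum.cong) auto
    with c insert.hyps show "(c a, c(a := 0)) \<in> Sigma {..N} (\<lambda>i. ?C S (N - i))"
      by (auto simp: exponent_counts_def)
  next
    fix y assume "y \<in> Sigma {..N} (\<lambda>i. ?C S (N - i))"
    then obtain i c where y: "y = (i, c)" and c: "i \<le> N" "c \<in> ?C S (N - i)" by auto
    have "sum (c(a := i)) S = sum c S"
      using insert.hyps by (intro sum.cong) auto
    with c insert.hyps show "(case y of (i, c) \<Rightarrow> c(a := i)) \<in> ?C (insert a S) N"
      by (auto simp: exponent_counts_def y)
  qed (use insert.hyps in \<open>auto simp: exponent_counts_def fun_eq_iff\<close>)
  finally show ?case by (simp add: T_def)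
qed

text \<open>
  Over disjoint sets the expansions multiply without interaction: a count on the union is the
  pointwise sum of its restrictions.
\<close>
lemma prod_multinomial_laurent:
  fixes x :: "'a \<Rightarrow> 'v expo"
  assumes "finite P" and "\<And>p. p \<in> P \<Longrightarrow> finite (B p)" and "disjoint_family_on B P"
  shows "(\<Prod>p\<in>P. (\<Sum>\<alpha>\<in>B p. Poly_Mapping.single (x \<alpha>) (1::complex)) ^ N p) =
    (\<Sum>c\<in>exponent_counts P B N.
       Poly_Mapping.single (\<Sum>\<alpha>\<in>\<Union> (B ` P). frag_cmul (int (c \<alpha>)) (x \<alpha>))
         ((\<Prod>p\<in>P. fact (N p)) / (\<Prod>\<alpha>\<in>\<Union> (B ` P). fact (c \<alpha>))))"
  using assms
proof (induction P rule: finite_induct)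
  case empty
  have "exponent_counts {} B N = {\<lambda>_. 0}" by (auto simp: exponent_counts_def)
  then show ?case by simp
next
  case (insert q P)
  let ?U = "\<Union> (B ` P)"
  let ?C = "exponent_counts {()} (\<lambda>_. B q) (\<lambda>_. N q)" and ?D = "exponent_counts P B N"
  have fin: "finite (B q)" "finite ?U" and disj: "B q \<inter> ?U = {}"
    using insert.prems insert.hyps by (auto simp: disjoint_family_on_def)
  have dP: "disjoint_family_on B P"
    using insert.prems(2) by (rule disjoint_family_on_mono[rotated]) auto
  define e where "e S c = (\<Sum>\<alpha>\<in>S. frag_cmul (int (c \<alpha>)) (x \<alpha>))" for S and c :: "'a \<Rightarrow> nat"
  define w where "w S c = (\<Prod>\<alpha>\<in>S. fact (c \<alpha>) :: complex)" for S and c :: "'a \<Rightarrow> nat"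
  have "(\<Prod>p\<in>insert q P. (\<Sum>\<alpha>\<in>B p. Poly_Mapping.single (x \<alpha>) (1::complex)) ^ N p) =
      (\<Sum>c\<in>?C. Poly_Mapping.single (e (B q) c) (fact (N q) / w (B q) c)) *
      (\<Sum>c\<in>?D. Poly_Mapping.single (e ?U c) ((\<Prod>p\<in>P. fact (N p)) / w ?U c))"
    using insert dP fin by (simp add: multinomial_laurent e_def w_def)
  also have "\<dots> = (\<Sum>(c, c')\<in>?C \<times> ?D.
      Poly_Mapping.single (e (B q) c + e ?U c') ((\<Prod>p\<in>insert q P. fact (N p)) / (w (B q) c * w ?U c')))"
    using insert.hyps by (simp add: sum_product sum.cartesian_product mult_single)
  also have "\<dots> = (\<Sum>c\<in>exponent_counts (insert q P) B N.
      Poly_Mapping.single (e (B q \<union> ?U) c) ((\<Prod>p\<in>insert q P. fact (N p)) / w (B q \<union> ?U) c))"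
  proof (rule sum.reindex_bij_witness[where j = "\<lambda>(c, c') \<alpha>. c \<alpha> + c' \<alpha>"
        and i = "\<lambda>c. (\<lambda>\<alpha>. if \<alpha> \<in> B q then c \<alpha> else 0, \<lambda>\<alpha>. if \<alpha> \<in> B q then 0 else c \<alpha>)"])
    fix y assume "y \<in> ?C \<times> ?D"
    then obtain c c' where y: "y = (c, c')" and c: "c \<in> ?C" and c': "c' \<in> ?D" by auto
    have z': "c' \<alpha> = 0" if "\<alpha> \<in> B q" for \<alpha>
      using that c' disj unfolding exponent_counts_def by blast
    have z: "c \<alpha> = 0" if "\<alpha> \<notin> B q" for \<alpha>
      using that c by (auto simp: exponent_counts_def)
    have eq: "(case y of (c, c') \<Rightarrow> \<lambda>\<alpha>. c \<alpha> + c' \<alpha>) \<alpha> = (if \<alpha> \<in> B q then c \<alpha> else c' \<alpha>)" for \<alpha>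
      by (simp add: y z z')
    have eqs: "sum (case y of (c, c') \<Rightarrow> \<lambda>\<alpha>. c \<alpha> + c' \<alpha>) (B p) = sum c' (B p)" if "p \<in> P" for p
      using that disj by (intro sum.cong) (auto simp: eq)
    show "(case y of (c, c') \<Rightarrow> \<lambda>\<alpha>. c \<alpha> + c' \<alpha>) \<in> exponent_counts (insert q P) B N"
      using c c' eqs by (auto simp: exponent_counts_def eq)
    show "(case (case y of (c, c') \<Rightarrow> \<lambda>\<alpha>. c \<alpha> + c' \<alpha>) of c \<Rightarrow>
        (\<lambda>\<alpha>. if \<alpha> \<in> B q then c \<alpha> else 0, \<lambda>\<alpha>. if \<alpha> \<in> B q then 0 else c \<alpha>)) = y"
      using z z' by (auto simp: y fun_eq_iff)
    have "e (B q \<union> ?U) (case y of (c, c') \<Rightarrow> \<lambda>\<alpha>. c \<alpha> + c' \<alpha>) = e (B q) c + e ?U c'"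
      unfolding e_def sum.union_disjoint[OF fin disj]
      using disj by (intro arg_cong2[where f = plus] sum.cong) (auto simp: eq)
    moreover have "w (B q \<union> ?U) (case y of (c, c') \<Rightarrow> \<lambda>\<alpha>. c \<alpha> + c' \<alpha>) = w (B q) c * w ?U c'"
      unfolding w_def prod.union_disjoint[OF fin disj]
      using disj by (intro arg_cong2[where f = times] prod.cong) (auto simp: eq)
    ultimately show "Poly_Mapping.single (e (B q \<union> ?U) (case y of (c, c') \<Rightarrow> \<lambda>\<alpha>. c \<alpha> + c' \<alpha>))
        ((\<Prod>p\<in>insert q P. fact (N p)) / w (B q \<union> ?U) (case y of (c, c') \<Rightarrow> \<lambda>\<alpha>. c \<alpha> + c' \<alpha>)) =
        (case y of (c, c') \<Rightarrow> Poly_Mapping.single (e (B q) c + e ?U c')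
          ((\<Prod>p\<in>insert q P. fact (N p)) / (w (B q) c * w ?U c')))"
      by (simp add: y)
  next
    fix c assume c: "c \<in> exponent_counts (insert q P) B N"
    have eqs: "(\<Sum>\<alpha>\<in>B p. if \<alpha> \<in> B q then 0 else c \<alpha>) = sum c (B p)" if "p \<in> P" for p
      using that disj by (intro sum.cong) auto
    show "(\<lambda>\<alpha>. if \<alpha> \<in> B q then c \<alpha> else 0, \<lambda>\<alpha>. if \<alpha> \<in> B q then 0 else c \<alpha>) \<in> ?C \<times> ?D"
      using c eqs by (auto simp: exponent_counts_def)
  qed auto
  finally show ?case by (simp add: e_def w_def)
qed

text \<open>
  The shape of \<open>f_Y\<close>: \<open>B 0\<close> enters linearly, the other sets through the product that carries the
  extra monomial \<open>a\<close>.  Choosing that product \<open>r\<close> times out of \<open>m\<close> uses the set \<open>B 0\<close> in total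
  \<open>m - r\<close> times and the set \<open>B p\<close> in total \<open>d p * r\<close> times.
\<close>
lemma constant_term_power_expansion:
  fixes x :: "'a \<Rightarrow> 'v expo" and a :: "'v expo" and d :: "nat \<Rightarrow> nat"
  assumes "\<And>p. p \<le> l \<Longrightarrow> finite (B p)" and "disjoint_family_on B {0..l}"
  defines "F \<equiv> \<lambda>p. \<Sum>\<alpha>\<in>B p. Poly_Mapping.single (x \<alpha>) (1::complex)"
  defines "N \<equiv> \<lambda>m r p. if p = 0 then m - r else d p * r"
  shows "constant_term ((F 0 + Poly_Mapping.single a 1 * (\<Prod>p=1..l. F p ^ d p)) ^ m) =
    (\<Sum>r\<le>m. \<Sum>c\<in>exponent_counts {0..l} B (N m r).
       if frag_cmul (int r) a + (\<Sum>\<alpha>\<in>\<Union> (B ` {0..l}). frag_cmul (int (c \<alpha>)) (x \<alpha>)) = 0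
       then of_nat (m choose r) * (\<Prod>p=0..l. fact (N m r p)) / (\<Prod>\<alpha>\<in>\<Union> (B ` {0..l}). fact (c \<alpha>))
       else 0)"
proof -
  have "(F 0 + Poly_Mapping.single a 1 * (\<Prod>p=1..l. F p ^ d p)) ^ m
      = (\<Sum>r\<le>m. of_nat (m choose r) * (Poly_Mapping.single a 1 * (\<Prod>p=1..l. F p ^ d p)) ^ r * F 0 ^ (m - r))"
    by (subst add.commute) (rule binomial_ring)
  also have "\<dots> = (\<Sum>r\<le>m. Poly_Mapping.single (frag_cmul (int r) a) (of_nat (m choose r)) *
      (\<Prod>p\<in>{0..l}. F p ^ N m r p))"
  proof (intro sum.cong refl)
    fix r
    have "(\<Prod>p=1..l. F p ^ d p) ^ r = (\<Prod>p=1..l. F p ^ N m r p)"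
      unfolding prod_power_distrib N_def by (intro prod.cong) (auto simp: power_mult)
    moreover have "(\<Prod>p\<in>{0..l}. F p ^ N m r p) = F 0 ^ (m - r) * (\<Prod>p=1..l. F p ^ N m r p)"
      by (simp add: prod.atLeast_Suc_atMost N_def)
    moreover have "Poly_Mapping.single (frag_cmul (int r) a) (of_nat (m choose r) :: complex)
        = of_nat (m choose r) * Poly_Mapping.single a 1 ^ r"
      by (simp add: single_power of_nat_mult_single)
    ultimately show "of_nat (m choose r) * (Poly_Mapping.single a 1 * (\<Prod>p=1..l. F p ^ d p)) ^ r * F 0 ^ (m - r)
      = Poly_Mapping.single (frag_cmul (int r) a) (of_nat (m choose r)) * (\<Prod>p\<in>{0..l}. F p ^ N m r p)"
      by (simp add: power_mult_distrib mult_ac)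
  qed
  also have "\<dots> = (\<Sum>r\<le>m. \<Sum>c\<in>exponent_counts {0..l} B (N m r).
     Poly_Mapping.single (frag_cmul (int r) a + (\<Sum>\<alpha>\<in>\<Union> (B ` {0..l}). frag_cmul (int (c \<alpha>)) (x \<alpha>)))
       (of_nat (m choose r) * (\<Prod>p=0..l. fact (N m r p)) / (\<Prod>\<alpha>\<in>\<Union> (B ` {0..l}). fact (c \<alpha>))))"
    unfolding F_def using assms(1,2)
    by (subst prod_multinomial_laurent) (auto simp: sum_distrib_left mult_single)
  finally show ?thesis
    by (simp add: constant_term_def lookup_sum lookup_single when_def)
qed

section \<open>Setting variables to one, and Laurent polynomials in given variables\<close>

lemma lookup_set_to_one_expo:
  "Poly_Mapping.lookup (set_to_one_expo W e) v = (if v \<in> W then 0 else Poly_Mapping.lookup e v)"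
  by (simp add: set_to_one_expo_def lookup_mapp when_def in_keys_iff)

lemma set_to_one_superset:
  assumes "finite K" and "Poly_Mapping.keys g \<subseteq> K"
  shows "set_to_one W g =
    (\<Sum>e\<in>K. Poly_Mapping.single (set_to_one_expo W e) (Poly_Mapping.lookup g e))"
  unfolding set_to_one_def
  using assms by (intro sum.mono_neutral_left) (auto simp: in_keys_iff)

lemma set_to_one_add: "set_to_one W (g + h) = set_to_one W g + set_to_one W h"
proof -
  let ?K = "Poly_Mapping.keys g \<union> Poly_Mapping.keys h"
  have "Poly_Mapping.keys (g + h) \<subseteq> ?K" by (rule keys_add)
  then show ?thesis
    by (simp add: set_to_one_superset[where K = ?K] lookup_add single_add sum.distrib)
qed

lemma set_to_one_single:
  "set_to_one W (Poly_Mapping.single e z) = Poly_Mapping.single (set_to_one_expo W e) z"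
  by (subst set_to_one_superset[where K = "{e}"]) auto

lemma set_to_one_sum: "set_to_one W (\<Sum>i\<in>I. g i) = (\<Sum>i\<in>I. set_to_one W (g i))"
proof (induction I rule: infinite_finite_induct)
  case (insert i I)
  then show ?case by (simp add: set_to_one_add)
qed (simp_all add: set_to_one_def)

lemma laurent_in_single: "Poly_Mapping.keys e \<subseteq> V \<Longrightarrow> laurent_in V (Poly_Mapping.single e z)"
  by (auto simp: laurent_in_def split: if_splits)

lemma laurent_in_add: "laurent_in V g \<Longrightarrow> laurent_in V h \<Longrightarrow> laurent_in V (g + h)"
  using keys_add[of g h] by (auto simp: laurent_in_def)

lemma laurent_in_mult:
  assumes "laurent_in V g" "laurent_in V h"
  shows "laurent_in V (g * h)"
  unfolding laurent_in_def
proof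
  fix e assume "e \<in> Poly_Mapping.keys (g * h)"
  then obtain a b where "e = a + b" "a \<in> Poly_Mapping.keys g" "b \<in> Poly_Mapping.keys h"
    using keys_mult[of g h] by auto
  then show "Poly_Mapping.keys e \<subseteq> V"
    using assms keys_add[of a b] unfolding laurent_in_def by blast
qed

lemma laurent_in_one: "laurent_in V 1"
  by (simp add: laurent_in_def)

lemma laurent_in_power: "laurent_in V g \<Longrightarrow> laurent_in V (g ^ N)"
  by (induction N) (auto intro: laurent_in_one laurent_in_mult)

lemma laurent_in_sum: "(\<And>i. i \<in> I \<Longrightarrow> laurent_in V (g i)) \<Longrightarrow> laurent_in V (\<Sum>i\<in>I. g i)"
  by (induction I rule: infinite_finite_induct) (auto simp: laurent_in_def[of V 0] intro: laurent_in_add)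

lemma laurent_in_prod: "(\<And>i. i \<in> I \<Longrightarrow> laurent_in V (g i)) \<Longrightarrow> laurent_in V (\<Prod>i\<in>I. g i)"
  by (induction I rule: infinite_finite_induct) (auto intro: laurent_in_one laurent_in_mult)

section \<open>The level of an arrow\<close>

text \<open>
  The last arrow is left out because its monomial is \<open>a\<close>, which enters \<open>f_Y\<close> as the separate factor
  in front of the product of the blocks.
\<close>
definition inner_arrows :: "nat \<Rightarrow> nat \<Rightarrow> arrow set" where
  "inner_arrows k n = arrows k n - {((k, n), (k, n + 1))}"

text \<open>
  The number \<open>q\<close> of the set \<open>E_set k n q\<close> that contains the arrow.  Every path from \<open>(0, 1)\<close> to
  \<open>(k, n + 1)\<close> uses exactly one arrow of each level \<open>1, \<dots>, k + n\<close>.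
\<close>
definition level :: "nat \<Rightarrow> arrow \<Rightarrow> nat" where
  "level k \<alpha> = (if fst (head \<alpha>) = fst (tail \<alpha>) then k + snd (tail \<alpha>) else fst (head \<alpha>))"

text \<open>
  The arrows of level \<open>q\<close> form a cut; this is its side that contains the source.
\<close>
definition before_level :: "nat \<Rightarrow> nat \<Rightarrow> vertex \<Rightarrow> bool" where
  "before_level k q v \<longleftrightarrow> (if q \<le> k then fst v < q else snd v \<le> q - k)"

lemma arrow_cases:
  assumes "\<alpha> \<in> arrows k n"
  obtains (vertical) i j where "\<alpha> = ((i, j), (i + 1, j))" "1 \<le> i" "i < k" "1 \<le> j" "j \<le> n"
  | (first) "\<alpha> = ((0, 1), (1, 1))"
  | (horizontal) i j where "\<alpha> = ((i, j), (i, j + 1))" "1 \<le> i" "i \<le> k" "1 \<le> j" "j < n"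
  | (last) "\<alpha> = ((k, n), (k, n + 1))"
  using assms by (fastforce simp: arrows_def vertical_arrows_def horizontal_arrows_def)

lemma finite_arrows: "finite (arrows k n)"
proof (rule finite_subset)
  show "arrows k n \<subseteq> ({0..k} \<times> {0..n + 1}) \<times> ({0..k + 1} \<times> {0..n + 1})"
    by (auto elim!: arrow_cases)
qed auto

lemma finite_inner_arrows: "finite (inner_arrows k n)"
  by (simp add: inner_arrows_def finite_arrows)

lemma level_bounds:
  assumes "\<alpha> \<in> arrows k n" "k \<ge> 1" "n \<ge> 1"
  shows "1 \<le> level k \<alpha>" and "level k \<alpha> \<le> k + n"
  using assms by (auto elim!: arrow_cases simp: level_def)

lemma inner_arrows_level:
  assumes "k \<ge> 1" "n \<ge> 1"
  shows "inner_arrows k n = {\<alpha> \<in> arrows k n. level k \<alpha> < k + n}"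
proof -
  have "level k \<alpha> < k + n \<longleftrightarrow> \<alpha> \<noteq> ((k, n), (k, n + 1))" if "\<alpha> \<in> arrows k n" for \<alpha>
    using that assms by (cases rule: arrow_cases) (auto simp: level_def)
  then show ?thesis by (auto simp: inner_arrows_def)
qed

lemma E_set_level:
  assumes "k \<ge> 1" "n \<ge> 1"
  shows "E_set k n q = {\<alpha> \<in> arrows k n. level k \<alpha> = q}"
  using assms
  by (auto simp: E_set_def arrows_def vertical_arrows_def horizontal_arrows_def level_def)

text \<open>
  The indicator function of the source side of a cut drops along the arrows of that cut and is
  constant along all other arrows.
\<close>
lemma inner_arrow_potential:
  assumes "\<alpha> \<in> inner_arrows k n" "q \<ge> 1" "k \<ge> 1"
  shows "(of_bool (before_level k q (tail \<alpha>)) - of_bool (before_level k q (head \<alpha>)) :: int)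
    = of_bool (level k \<alpha> = q)"
proof -
  have "\<alpha> \<in> arrows k n" "\<alpha> \<noteq> ((k, n), (k, n + 1))"
    using assms(1) by (auto simp: inner_arrows_def)
  then show ?thesis
    using assms(2,3) by (cases rule: arrow_cases) (auto simp: before_level_def level_def)
qed

lemma u_sum_Suc: "u_sum d (Suc p) = u_sum d p + d (Suc p)"
  by (simp add: u_sum_def)

lemma u_sum_less:
  assumes "\<And>i. i \<in> {1..l} \<Longrightarrow> d i \<ge> 1" "p < p'" "p' \<le> l"
  shows "u_sum d p < u_sum d p'"
  using assms(2,3)
proof (induction p' rule: less_induct)
  case (less p')
  then obtain m where m: "p' = Suc m" by (cases p') auto
  have "d (Suc m) \<ge> 1" using assms(1) less.prems m by auto
  then show ?case
    using less.IH[of m] less.prems m by (cases "p = m") (auto simp: u_sum_Suc)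
qed

lemma u_sum_mono: "p \<le> p' \<Longrightarrow> u_sum d p \<le> u_sum d p'"
  unfolding u_sum_def by (intro sum_mono2) auto

lemma block_level:
  assumes "k \<ge> 1" "n \<ge> 1"
  shows "block k n d p = {\<alpha> \<in> arrows k n. u_sum d (p - 1) < level k \<alpha> \<and> level k \<alpha> \<le> u_sum d p}"
  using assms by (auto simp: block_def E_set_level)

lemma Union_blocks:
  assumes "k \<ge> 1" "n \<ge> 1"
  shows "(\<Union>p\<in>{1..l}. block k n d p) = {\<alpha> \<in> arrows k n. level k \<alpha> \<le> u_sum d l}"
proof (induction l)
  case 0
  then show ?case using level_bounds(1)[OF _ assms] by (fastforce simp: u_sum_def)
next
  case (Suc l)
  have "(\<Union>p\<in>{1..Suc l}. block k n d p) = (\<Union>p\<in>{1..l}. block k n d p) \<union> block k n d (Suc l)"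
    by (simp add: atLeastAtMostSuc_conv Un_commute)
  also have "\<dots> = {\<alpha> \<in> arrows k n. level k \<alpha> \<le> u_sum d (Suc l)}"
    using u_sum_mono[of l "Suc l" d] unfolding Suc by (auto simp: block_level[OF assms])
  finally show ?case .
qed

lemma A_set_level:
  assumes "k \<ge> 1" "n \<ge> 1"
  shows "A_set k n l d = {\<alpha> \<in> inner_arrows k n. u_sum d l < level k \<alpha>}"
  unfolding A_set_def block0_def Union_blocks[OF assms] inner_arrows_def by auto

text \<open>
  The indexing that fits the power expansion: index \<open>0\<close> is the set that enters \<open>f_Y\<close> linearly.
\<close>
definition parts :: "nat \<Rightarrow> nat \<Rightarrow> nat \<Rightarrow> (nat \<Rightarrow> nat) \<Rightarrow> nat \<Rightarrow> arrow set" where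
  "parts k n l d p = (if p = 0 then A_set k n l d else block k n d p)"

lemma finite_parts:
  assumes "k \<ge> 1" "n \<ge> 1"
  shows "finite (parts k n l d p)"
  by (simp add: parts_def A_set_level[OF assms] block_level[OF assms] finite_arrows finite_inner_arrows)

lemma parts_partition:
  assumes "k \<ge> 1" "n \<ge> 1" "u_sum d l < k + n"
  shows "disjoint_family_on (parts k n l d) {0..l}" and "\<Union> (parts k n l d ` {0..l}) = inner_arrows k n"
proof -
  have "{0..l} = insert 0 {1..l}" by auto
  then have "\<Union> (parts k n l d ` {0..l}) = A_set k n l d \<union> (\<Union>p\<in>{1..l}. block k n d p)"
    by (auto simp: parts_def)
  also have "\<dots> = inner_arrows k n"
    using assms(3) unfolding Union_blocks[OF assms(1,2)]
    by (auto simp: A_set_level[OF assms(1,2)] inner_arrows_level[OF assms(1,2)])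
  finally show "\<Union> (parts k n l d ` {0..l}) = inner_arrows k n" .
  have less: "parts k n l d p \<inter> parts k n l d p' = {}" if "p < p'" "p' \<le> l" for p p'
  proof (cases "p = 0")
    case True
    with that show ?thesis
      using u_sum_mono[of p' l d] by (auto simp: parts_def A_set_level[OF assms(1,2)] block_level[OF assms(1,2)])
  next
    case False
    with that have "p \<le> p' - 1" "p' \<noteq> 0" by auto
    with False show ?thesis
      using u_sum_mono[of p "p' - 1" d] by (auto simp: parts_def block_level[OF assms(1,2)])
  qed
  show "disjoint_family_on (parts k n l d) {0..l}"
    unfolding disjoint_family_on_def
    using less by (metis Int_commute atLeastAtMost_iff nat_neq_iff)
qed

lemma sum_levels:
  fixes c :: "arrow \<Rightarrow> nat"
  assumes "k \<ge> 1" "n \<ge> 1"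
  shows "sum c {\<alpha> \<in> arrows k n. level k \<alpha> \<in> Q} = (\<Sum>q\<in>Q \<inter> {1..k+n}. sum c (E_set k n q))"
proof -
  have "{\<alpha> \<in> arrows k n. level k \<alpha> \<in> Q} = (\<Union>q\<in>Q \<inter> {1..k+n}. E_set k n q)"
    using level_bounds[OF _ assms] by (auto simp: E_set_level[OF assms])
  then show ?thesis
    by (simp, subst sum.UNION_disjoint) (auto simp: E_set_level[OF assms] finite_arrows)
qed

section \<open>Balanced exponents are flows\<close>

text \<open>
  Flows of value \<open>r\<close> from \<open>(0, 1)\<close> to \<open>(k, n)\<close>, described by duality: instead of demanding balance at
  each vertex, test against all potentials \<open>\<psi>\<close>.  Indicator functions of vertices give the balance
  equations back, while other potentials give the flow through a cut in one step.  The condition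
  \<open>\<psi> (k, n) = 0\<close> reflects that the vertex \<open>(k, n)\<close> carries the constant \<open>1\<close> instead of a variable.
\<close>
definition flows :: "nat \<Rightarrow> nat \<Rightarrow> nat \<Rightarrow> (arrow \<Rightarrow> nat) set" where
  "flows k n r = {c. (\<forall>\<alpha>. \<alpha> \<notin> inner_arrows k n \<longrightarrow> c \<alpha> = 0) \<and>
     (\<forall>\<psi> :: vertex \<Rightarrow> int. \<psi> (k, n) = 0 \<longrightarrow>
        int r * \<psi> (0, 1) + (\<Sum>\<alpha>\<in>inner_arrows k n. int (c \<alpha>) * (\<psi> (head \<alpha>) - \<psi> (tail \<alpha>))) = 0)}"

text \<open>
  The balance defect that the cut of level \<open>q\<close> detects in an arbitrary count, flow or not.
\<close>
lemma potential_level: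
  assumes "k \<ge> 1" "n \<ge> 1" "q \<ge> 1"
  defines "\<psi> \<equiv> (\<lambda>v. - of_bool (before_level k q v) :: int)"
  assumes "q < k + n"
  shows "int r * \<psi> (0, 1) + (\<Sum>\<alpha>\<in>inner_arrows k n. int (c \<alpha>) * (\<psi> (head \<alpha>) - \<psi> (tail \<alpha>)))
    = int (sum c (E_set k n q)) - int r"
proof -
  have "(\<Sum>\<alpha>\<in>inner_arrows k n. int (c \<alpha>) * (\<psi> (head \<alpha>) - \<psi> (tail \<alpha>)))
    = (\<Sum>\<alpha>\<in>inner_arrows k n. if level k \<alpha> = q then int (c \<alpha>) else 0)"
  proof (intro sum.cong refl)
    fix \<alpha> assume "\<alpha> \<in> inner_arrows k n"
    from inner_arrow_potential[OF this assms(3,1)]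
    show "int (c \<alpha>) * (\<psi> (head \<alpha>) - \<psi> (tail \<alpha>)) = (if level k \<alpha> = q then int (c \<alpha>) else 0)"
      by (auto simp: \<psi>_def of_bool_def split: if_splits)
  qed
  also have "\<dots> = int (sum c (E_set k n q))"
    using assms(5) by (subst sum.inter_filter[OF finite_inner_arrows, symmetric])
      (auto simp: E_set_level[OF assms(1,2)] inner_arrows_level[OF assms(1,2)] intro!: sum.cong)
  finally show ?thesis using assms(3) by (auto simp: \<psi>_def before_level_def)
qed

lemma flow_through_level:
  assumes "k \<ge> 1" "n \<ge> 1" "c \<in> flows k n r" "1 \<le> q" "q < k + n"
  shows "sum c (E_set k n q) = r"
proof -
  have "- of_bool (before_level k q (k, n)) = (0 :: int)"
    using assms by (auto simp: before_level_def)
  moreover have "\<psi> (k, n) = 0 \<Longrightarrow> int r * \<psi> (0, 1) + (\<Sum>\<alpha>\<in>inner_arrows k n.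
      int (c \<alpha>) * (\<psi> (head \<alpha>) - \<psi> (tail \<alpha>))) = 0" for \<psi> :: "vertex \<Rightarrow> int"
    using assms(3) by (simp add: flows_def)
  note this[of "\<lambda>v. - of_bool (before_level k q v)"]
  ultimately have "int r * (- of_bool (before_level k q (0, 1))) + (\<Sum>\<alpha>\<in>inner_arrows k n.
      int (c \<alpha>) * (- of_bool (before_level k q (head \<alpha>)) - (- of_bool (before_level k q (tail \<alpha>))))) = 0"
    by blast
  then show ?thesis using potential_level[OF assms(1,2,4,5), of r c] by (simp del: of_nat_sum)
qed

lemma inner_arrow_vertices:
  assumes "\<alpha> \<in> inner_arrows k n" "k \<ge> 1" "n \<ge> 1"
  shows "tail \<alpha> \<in> insert (k, n) (variables k n)" "head \<alpha> \<in> insert (k, n) (variables k n)"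
  using assms by (auto simp: inner_arrows_def variables_def elim!: arrow_cases)

definition arrow_expo :: "nat \<Rightarrow> nat \<Rightarrow> arrow \<Rightarrow> vertex expo" where
  "arrow_expo k n \<alpha> = vertex_expo k n (head \<alpha>) - vertex_expo k n (tail \<alpha>)"

text \<open>
  The exponent vector of \<open>a\<^sup>r\<close> times the product of the arrow monomials with multiplicities \<open>c\<close>.
\<close>
definition total_expo :: "nat \<Rightarrow> nat \<Rightarrow> nat \<Rightarrow> (arrow \<Rightarrow> nat) \<Rightarrow> vertex expo" where
  "total_expo k n r c = frag_cmul (int r) (Poly_Mapping.single (0, 1) 1) +
     (\<Sum>\<alpha>\<in>inner_arrows k n. frag_cmul (int (c \<alpha>)) (arrow_expo k n \<alpha>))"

lemma finite_variables: "finite (variables k n)"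
  by (simp add: variables_def)

text \<open>
  Potentials are linear functionals on exponent vectors.  A potential that vanishes at \<open>(k, n)\<close> takes
  the value \<open>\<psi> w\<close> on the exponent of the vertex \<open>w\<close>, including \<open>w = (k, n)\<close> itself.
\<close>
lemma vertex_expo_pairing:
  fixes \<psi> :: "vertex \<Rightarrow> int"
  assumes "w \<in> insert (k, n) (variables k n)" "\<psi> (k, n) = 0" "k \<ge> 1"
  shows "(\<Sum>v\<in>variables k n. \<psi> v * Poly_Mapping.lookup (vertex_expo k n w) v) = \<psi> w"
proof (cases "w = (k, n)")
  case False
  then have "w \<in> variables k n" and "w \<noteq> (k, n + 1)"
    using assms by (auto simp: variables_def)
  with False show ?thesis
    by (simp add: vertex_expo_def lookup_single when_def finite_variables if_distrib eq_commute[of w] cong: if_cong)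
qed (simp add: vertex_expo_def assms)

lemma total_expo_pairing:
  fixes \<psi> :: "vertex \<Rightarrow> int"
  assumes "\<psi> (k, n) = 0" "k \<ge> 1" "n \<ge> 1"
  shows "(\<Sum>v\<in>variables k n. \<psi> v * Poly_Mapping.lookup (total_expo k n r c) v) =
    int r * \<psi> (0, 1) + (\<Sum>\<alpha>\<in>inner_arrows k n. int (c \<alpha>) * (\<psi> (head \<alpha>) - \<psi> (tail \<alpha>)))"
proof -
  define pair where "pair e = (\<Sum>v\<in>variables k n. \<psi> v * Poly_Mapping.lookup e v)" for e :: "vertex expo"
  have add: "pair (e + e') = pair e + pair e'" for e e'
    by (simp add: pair_def lookup_add distrib_left sum.distrib)
  have diff: "pair (e - e') = pair e - pair e'" for e e'
    by (simp add: pair_def lookup_minus right_diff_distrib sum_subtractf)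
  have cmul: "pair (frag_cmul z e) = z * pair e" for z e
    by (simp add: pair_def sum_distrib_left mult.left_commute)
  have sum: "pair (\<Sum>i\<in>I. f i) = (\<Sum>i\<in>I. pair (f i))" for I and f :: "arrow \<Rightarrow> vertex expo"
    unfolding pair_def lookup_sum sum_distrib_left by (rule sum.swap)
  have vertex: "pair (vertex_expo k n w) = \<psi> w" if "w \<in> insert (k, n) (variables k n)" for w
    unfolding pair_def by (rule vertex_expo_pairing[of w k n \<psi>, OF that assms(1,2)])
  have "Poly_Mapping.single (0, 1) 1 = vertex_expo k n (0, 1)"
    using assms(2) by (simp add: vertex_expo_def)
  moreover have "(0, 1) \<in> variables k n" by (simp add: variables_def)
  ultimately have "pair (total_expo k n r c) =
      int r * \<psi> (0, 1) + (\<Sum>\<alpha>\<in>inner_arrows k n. int (c \<alpha>) * (\<psi> (head \<alpha>) - \<psi> (tail \<alpha>)))"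
    using inner_arrow_vertices[OF _ assms(2,3)]
    by (simp only: total_expo_def arrow_expo_def add diff cmul sum vertex insertI2 cong: sum.cong)
  then show ?thesis by (simp only: pair_def)
qed

lemma lookup_total_expo_outside:
  assumes "v \<notin> variables k n" "k \<ge> 1" "n \<ge> 1"
  shows "Poly_Mapping.lookup (total_expo k n r c) v = 0"
proof -
  have *: "Poly_Mapping.lookup (vertex_expo k n w) v = 0" if "w \<in> insert (k, n) (variables k n)" for w
    using that assms by (auto simp: vertex_expo_def lookup_single when_def variables_def)
  have "(0, 1) \<in> variables k n" by (simp add: variables_def)
  with assms(1) have "v \<noteq> (0, 1)" by auto
  with * inner_arrow_vertices[OF _ assms(2,3)] show ?thesis
    by (simp add: total_expo_def arrow_expo_def lookup_add lookup_sum lookup_minus lookup_single when_def)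
qed

text \<open>
  A vector vanishes iff all linear functionals vanish on it, so a count is a flow iff its total
  monomial is trivial.
\<close>
lemma flows_iff_total_expo:
  assumes "k \<ge> 1" "n \<ge> 1"
  shows "c \<in> flows k n r \<longleftrightarrow> (\<forall>\<alpha>. \<alpha> \<notin> inner_arrows k n \<longrightarrow> c \<alpha> = 0) \<and> total_expo k n r c = 0"
proof -
  have "total_expo k n r c = 0"
    if flow: "\<And>\<psi> :: vertex \<Rightarrow> int. \<psi> (k, n) = 0 \<Longrightarrow>
      int r * \<psi> (0, 1) + (\<Sum>\<alpha>\<in>inner_arrows k n. int (c \<alpha>) * (\<psi> (head \<alpha>) - \<psi> (tail \<alpha>))) = 0"
  proof (rule poly_mapping_eqI)
    fix v
    show "Poly_Mapping.lookup (total_expo k n r c) v = Poly_Mapping.lookup 0 v"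
    proof (cases "v \<in> variables k n")
      case True
      let ?\<psi> = "\<lambda>w. of_bool (w = v) :: int"
      have 0: "?\<psi> (k, n) = 0" using True assms by (auto simp: variables_def)
      have "Poly_Mapping.lookup (total_expo k n r c) v =
          (\<Sum>w\<in>variables k n. ?\<psi> w * Poly_Mapping.lookup (total_expo k n r c) w)"
        using True by (simp add: finite_variables of_bool_def if_distrib[of "\<lambda>z. z * _"] cong: if_cong)
      also have "\<dots> = 0"
        unfolding total_expo_pairing[of ?\<psi>, OF 0 assms] by (rule flow[of ?\<psi>, OF 0])
      finally show ?thesis by simp
    qed (simp add: lookup_total_expo_outside[OF _ assms])
  qed
  moreover have "int r * \<psi> (0, 1) + (\<Sum>\<alpha>\<in>inner_arrows k n. int (c \<alpha>) * (\<psi> (head \<alpha>) - \<psi> (tail \<alpha>))) = 0"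
    if "total_expo k n r c = 0" "\<psi> (k, n) = 0" for \<psi> :: "vertex \<Rightarrow> int"
    using total_expo_pairing[where \<psi> = \<psi> and r = r and c = c, OF that(2) assms] that(1) by simp
  ultimately show ?thesis by (auto simp: flows_def)
qed

section \<open>Independence of the weight variables\<close>

text \<open>
  A path from the source to the weight vertex of block \<open>p\<close> uses exactly the levels below
  \<open>u_sum d p\<close>.
\<close>
lemma weight_vertex_before_level:
  assumes "u_sum d p \<ge> 1" "q \<ge> 1"
  shows "before_level k q (weight_vertex k d p) \<longleftrightarrow> u_sum d p \<le> q"
  using assms by (auto simp: before_level_def weight_vertex_def)

lemma u_sum_pos:
  assumes "\<And>i. i \<in> {1..l} \<Longrightarrow> d i \<ge> 1" "p \<in> {1..l}"
  shows "u_sum d p \<ge> 1"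
  using u_sum_less[of l d 0 p] assms by (auto simp: u_sum_def)

text \<open>
  The cut of level \<open>u_sum d p\<close> has the weight vertex of block \<open>p\<close> on its source side and those of all
  later blocks on the other side.
\<close>
lemma inj_on_weight_vertex:
  assumes "\<And>i. i \<in> {1..l} \<Longrightarrow> d i \<ge> 1"
  shows "inj_on (weight_vertex k d) {1..l}"
proof (rule linorder_inj_onI)
  fix p p' assume p: "p < p'" "p \<in> {1..l}" "p' \<in> {1..l}"
  have "u_sum d p < u_sum d p'" using p by (intro u_sum_less[OF assms]) auto
  then have "before_level k (u_sum d p) (weight_vertex k d p) \<and>
      \<not> before_level k (u_sum d p) (weight_vertex k d p')"
    using u_sum_pos[OF assms p(2)] u_sum_pos[OF assms p(3)]
    by (simp add: weight_vertex_before_level)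
  then show "weight_vertex k d p \<noteq> weight_vertex k d p'" by auto
qed auto

lemma weight_variables_subset:
  assumes "\<And>i. i \<in> {1..l} \<Longrightarrow> d i \<ge> 1" "u_sum d l < k + n" "k \<ge> 1" "n \<ge> 1"
  shows "weight_variables k l d \<subseteq> variables k n"
proof
  fix v assume "v \<in> weight_variables k l d"
  then obtain p where p: "p \<in> {1..l}" and v: "v = weight_vertex k d p"
    by (auto simp: weight_variables_def)
  have "u_sum d p \<ge> 1" using u_sum_pos[OF assms(1) p] .
  moreover have "u_sum d p < k + n" using u_sum_mono[of p l d] p assms(2) by auto
  ultimately show "v \<in> variables k n"
    using assms(3,4) by (auto simp: v weight_vertex_def variables_def)
qed

text \<open>
  For each block \<open>p\<close>, the potentials \<open>\<lambda>v. - of_bool (before_level k q v)\<close>, summed over the levels \<open>q\<close>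
  of the block, define a grading of the monomials in which the arrows of block \<open>p\<close> have degree \<open>1\<close> and all other inner arrows have degree \<open>0\<close>.  On the weight
  variables the matrix of these \<open>l\<close> degrees is triangular: the weight vertex of block \<open>p\<close> lies before
  only the last level of block \<open>p\<close>, hence has degree \<open>-1\<close>, and those of later blocks lie
  beyond the block, hence have degree \<open>0\<close>.  A monomial in the weight variables with all
  degrees \<open>0\<close> is therefore trivial.
\<close>
lemma weight_expo_eq_zero:
  fixes e :: "vertex expo"
  assumes d: "\<And>i. i \<in> {1..l} \<Longrightarrow> d i \<ge> 1" and bound: "u_sum d l < k + n" "k \<ge> 1" "n \<ge> 1"
    and supp: "\<And>v. v \<notin> weight_variables k l d \<Longrightarrow> Poly_Mapping.lookup e v = 0"
    and deg: "\<And>p. p \<in> {1..l} \<Longrightarrow> (\<Sum>v\<in>variables k n.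
      (\<Sum>q\<in>{u_sum d (p - 1) + 1..u_sum d p}. - of_bool (before_level k q v)) * Poly_Mapping.lookup e v) = 0"
  shows "e = 0"
proof (rule poly_mapping_eqI)
  let ?w = "weight_vertex k d"
  have zero: "Poly_Mapping.lookup e (?w p) = 0" if "p \<in> {1..l}" for p
    using that
  proof (induction p rule: less_induct)
    case (less p)
    let ?Q = "{u_sum d (p - 1) + 1..u_sum d p}"
    have "0 = (\<Sum>v\<in>variables k n. (\<Sum>q\<in>?Q. - of_bool (before_level k q v)) * Poly_Mapping.lookup e v)"
      using deg[OF less.prems] by simp
    also have "\<dots> = (\<Sum>v\<in>weight_variables k l d. (\<Sum>q\<in>?Q. - of_bool (before_level k q v)) * Poly_Mapping.lookup e v)"
      using weight_variables_subset[OF d bound] supp finite_variables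
      by (intro sum.mono_neutral_right) auto
    also have "\<dots> = (\<Sum>p'\<in>{1..l}. (\<Sum>q\<in>?Q. - of_bool (before_level k q (?w p'))) * Poly_Mapping.lookup e (?w p'))"
      unfolding weight_variables_def by (subst sum.reindex[OF inj_on_weight_vertex[OF d]]) auto
    also have "\<dots> = (\<Sum>p'\<in>{1..l}. if p' = p then - Poly_Mapping.lookup e (?w p) else 0)"
    proof (intro sum.cong refl)
      fix p' assume p': "p' \<in> {1..l}"
      have before: "before_level k q (?w p') \<longleftrightarrow> u_sum d p' \<le> q" if "q \<in> ?Q" for q
        using that by (intro weight_vertex_before_level u_sum_pos[OF d p']) auto
      consider "p' < p" | "p' = p" | "p < p'" by linarith
      then show "(\<Sum>q\<in>?Q. - of_bool (before_level k q (?w p'))) * Poly_Mapping.lookup e (?w p')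
          = (if p' = p then - Poly_Mapping.lookup e (?w p) else 0)"
      proof cases
        case 1
        then show ?thesis using less.IH p' by simp
      next
        case 2
        have "u_sum d (p - 1) < u_sum d p"
          using less.prems by (intro u_sum_less[OF d]) auto
        then have "(\<Sum>q\<in>?Q. - of_bool (before_level k q (?w p')) :: int) = (\<Sum>q\<in>?Q. if q = u_sum d p then -1 else 0)"
          using before 2 by (intro sum.cong) auto
        also have "\<dots> = -1"
          using \<open>u_sum d (p - 1) < u_sum d p\<close> by (subst sum.delta) auto
        finally show ?thesis using 2 by simp
      next
        case 3
        then have "u_sum d p < u_sum d p'" using p' by (intro u_sum_less[OF d]) auto
        with before 3 show ?thesis by simp
      qed
    qed
    also have "\<dots> = - Poly_Mapping.lookup e (?w p)"
      using less.prems by simp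
    finally show ?case by simp
  qed
  fix v
  show "Poly_Mapping.lookup e v = Poly_Mapping.lookup 0 v"
    using zero supp by (cases "v \<in> weight_variables k l d") (auto simp: weight_variables_def)
qed

section \<open>Flows as differences of heights\<close>

text \<open>
  The arrows of the grid in coordinates in which columns are counted from the right, \<open>j\<close> standing for
  the column \<open>n - j\<close>.  In these coordinates the heights below increase in both indices, as the
  entries \<open>s\<^sub>i\<^sub>,\<^sub>j\<close> of the \<open>I\<close>-series do.
\<close>
definition vert :: "nat \<Rightarrow> nat \<Rightarrow> nat \<Rightarrow> arrow" where
  "vert n i j = ((i, n - j), (i + 1, n - j))"

definition hori :: "nat \<Rightarrow> nat \<Rightarrow> nat \<Rightarrow> arrow" where
  "hori n i j = ((i + 1, n - j), (i + 1, n - j + 1))"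

lemma inner_arrows_eq:
  assumes "k \<ge> 1" "n \<ge> 1"
  shows "inner_arrows k n = insert ((0, 1), (1, 1))
    (case_prod (vert n) ` ({1..<k} \<times> {..<n}) \<union> case_prod (hori n) ` ({..<k} \<times> {1..<n}))" (is "_ = ?R")
proof
  show "inner_arrows k n \<subseteq> ?R"
  proof
    fix \<alpha> assume "\<alpha> \<in> inner_arrows k n"
    then have "\<alpha> \<in> arrows k n" and ne: "\<alpha> \<noteq> ((k, n), (k, n + 1))" by (auto simp: inner_arrows_def)
    then show "\<alpha> \<in> ?R"
    proof (cases rule: arrow_cases)
      case (vertical i j)
      then have "\<alpha> = case_prod (vert n) (i, n - j)" "(i, n - j) \<in> {1..<k} \<times> {..<n}"
        by (auto simp: vert_def)
      then show ?thesis by blast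
    next
      case (horizontal i j)
      then have "\<alpha> = case_prod (hori n) (i - 1, n - j)" "(i - 1, n - j) \<in> {..<k} \<times> {1..<n}"
        by (auto simp: hori_def)
      then show ?thesis by blast
    qed (use ne in auto)
  qed
  have "vert n i j \<in> inner_arrows k n" if "1 \<le> i" "i < k" "j < n" for i j
    using that by (auto simp: inner_arrows_def vert_def arrows_def vertical_arrows_def)
  moreover have "hori n i j \<in> inner_arrows k n" if "i < k" "1 \<le> j" "j < n" for i j
  proof -
    have "n - j \<in> {1..n-1}" "i + 1 \<in> {1..k}" using that by auto
    then show ?thesis
      by (auto simp: inner_arrows_def hori_def arrows_def horizontal_arrows_def)
  qed
  moreover have "((0, 1), (1, 1)) \<in> inner_arrows k n"
    using assms by (auto simp: inner_arrows_def arrows_def vertical_arrows_def)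
  ultimately show "?R \<subseteq> inner_arrows k n" by auto
qed

text \<open>
  Stated for an arbitrary commutative monoid, so that it applies to sums and to products.
\<close>
lemma (in comm_monoid_set) inner_arrows:
  assumes "k \<ge> 1" "n \<ge> 1"
  shows "F g (inner_arrows k n) = f (g ((0, 1), (1, 1)))
    (f (F (\<lambda>i. F (\<lambda>j. g (vert n i j)) {..<n}) {1..<k})
       (F (\<lambda>i. F (\<lambda>j. g (hori n i j)) {1..<n}) {..<k}))"
proof -
  have inj: "inj_on (case_prod (vert n)) ({1..<k} \<times> {..<n})" "inj_on (case_prod (hori n)) ({..<k} \<times> {1..<n})"
    by (auto simp: inj_on_def vert_def hori_def)
  have "F g (inner_arrows k n) = f (g ((0, 1), (1, 1)))
      (f (F g (case_prod (vert n) ` ({1..<k} \<times> {..<n}))) (F g (case_prod (hori n) ` ({..<k} \<times> {1..<n}))))"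
    unfolding inner_arrows_eq[OF assms]
    by (subst insert, simp, force simp: vert_def hori_def, subst union_disjoint) (auto simp: vert_def hori_def)
  also have "F g (case_prod (vert n) ` ({1..<k} \<times> {..<n})) = F (\<lambda>i. F (\<lambda>j. g (vert n i j)) {..<n}) {1..<k}"
    by (subst reindex[OF inj(1)]) (simp add: cartesian_product comp_def case_prod_unfold)
  also have "F g (case_prod (hori n) ` ({..<k} \<times> {1..<n})) = F (\<lambda>i. F (\<lambda>j. g (hori n i j)) {1..<n}) {..<k}"
    by (subst reindex[OF inj(2)]) (simp add: cartesian_product comp_def case_prod_unfold)
  finally show ?thesis .
qed

lemma E_set_vert:
  assumes "k \<ge> 1" "n \<ge> 1" "1 \<le> i" "i < k"
  shows "E_set k n (i + 1) = vert n i ` {..<n}"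
proof -
  have "E_set k n (i + 1) = (\<lambda>j. ((i, j), (i + 1, j))) ` {1..n}"
    using assms by (auto simp: E_set_def vertical_arrows_def)
  also have "{1..n} = (\<lambda>j. n - j) ` {..<n}"
  proof -
    have "x \<in> (\<lambda>j. n - j) ` {..<n}" if "x \<in> {1..n}" for x
      using that by (intro image_eqI[of _ _ "n - x"]) auto
    then show ?thesis by auto
  qed
  finally show ?thesis by (simp add: image_image vert_def)
qed

lemma E_set_hori:
  assumes "k \<ge> 1" "1 \<le> j" "j < n"
  shows "E_set k n (k + n - j) = (\<lambda>i. hori n i j) ` {..<k}"
proof -
  have "E_set k n (k + n - j) = (\<lambda>i. ((i, n - j), (i, n - j + 1))) ` {1..k}"
    using assms by (auto simp: E_set_def horizontal_arrows_def)
  also have "{1..k} = (\<lambda>i. i + 1) ` {..<k}"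
    using image_Suc_lessThan[of k] by simp
  finally show ?thesis by (simp add: image_image hori_def)
qed

lemma E_set_first: "k \<ge> 1 \<Longrightarrow> E_set k n 1 = {((0, 1), (1, 1))}"
  by (auto simp: E_set_def vertical_arrows_def)

lemma finite_flows:
  assumes "k \<ge> 1" "n \<ge> 1"
  shows "finite (flows k n r)"
proof (rule finite_subset)
  have "(\<Union> (E_set k n ` {1..<k+n})) = inner_arrows k n"
    using level_bounds[OF _ assms] by (auto simp: E_set_level[OF assms] inner_arrows_level[OF assms])
  then show "flows k n r \<subseteq> exponent_counts {1..<k+n} (E_set k n) (\<lambda>_. r)"
    using flow_through_level[OF assms] by (auto simp: exponent_counts_def flows_def)
  show "finite (exponent_counts {1..<k+n} (E_set k n) (\<lambda>_. r))"
    by (intro finite_exponent_counts) (auto simp: E_set_level[OF assms] finite_arrows)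
qed

text \<open>
  Planarity.  The vertices in rows \<open>1, \<dots>, i\<close> and in the last \<open>j\<close> columns contain neither source nor
  sink, so what enters this corner region from the left leaves it downwards.  The common value is
  the height of the face at \<open>(i, j)\<close>.
\<close>
lemma flow_through_corner:
  assumes "k \<ge> 1" "n \<ge> 1" "c \<in> flows k n r" "1 \<le> i" "i < k" "1 \<le> j" "j < n"
  shows "(\<Sum>j'<j. c (vert n i j')) = (\<Sum>i'<i. c (hori n i' j))"
proof -
  define \<psi> :: "vertex \<Rightarrow> int" where "\<psi> v = of_bool (fst v \<le> i \<and> n - j < snd v)" for v
  have "\<psi> (k, n) = 0" "\<psi> (0, 1) = 0" using assms by (auto simp: \<psi>_def)
  then have balance: "(\<Sum>\<alpha>\<in>inner_arrows k n. int (c \<alpha>) * (\<psi> (head \<alpha>) - \<psi> (tail \<alpha>))) = 0"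
    using assms(3) by (force simp: flows_def)
  have "\<psi> (1, 1) = 0" using assms by (auto simp: \<psi>_def)
  have row: "(\<Sum>j'<n. int (c (vert n i' j')) * (\<psi> (head (vert n i' j')) - \<psi> (tail (vert n i' j'))))
      = (if i' = i then - (\<Sum>j'<j. int (c (vert n i j'))) else 0)" if "i' \<in> {1..<k}" for i'
  proof -
    have "(\<Sum>j'<n. int (c (vert n i' j')) * (\<psi> (head (vert n i' j')) - \<psi> (tail (vert n i' j'))))
      = (\<Sum>j'<n. if j' \<in> {..<j} then (if i' = i then - int (c (vert n i j')) else 0) else 0)"
      using that assms by (intro sum.cong) (auto simp: \<psi>_def vert_def)
    also have "\<dots> = (\<Sum>j'<j. if i' = i then - int (c (vert n i j')) else 0)"
      using assms by (intro sum.mono_neutral_cong_right) auto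
    finally show ?thesis by (auto simp: sum_negf)
  qed
  have "(\<Sum>i'\<in>{1..<k}. \<Sum>j'<n. int (c (vert n i' j')) * (\<psi> (head (vert n i' j')) - \<psi> (tail (vert n i' j'))))
      = (\<Sum>i'\<in>{1..<k}. if i' = i then - (\<Sum>j'<j. int (c (vert n i j'))) else 0)"
    by (intro sum.cong refl row)
  also have "\<dots> = - (\<Sum>j'<j. int (c (vert n i j')))"
    using assms by simp
  finally have rows: "(\<Sum>i'\<in>{1..<k}. \<Sum>j'<n. int (c (vert n i' j')) * (\<psi> (head (vert n i' j')) - \<psi> (tail (vert n i' j'))))
      = - (\<Sum>j'<j. int (c (vert n i j')))" .
  have column: "(\<Sum>j'\<in>{1..<n}. int (c (hori n i' j')) * (\<psi> (head (hori n i' j')) - \<psi> (tail (hori n i' j'))))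
      = (if i' < i then int (c (hori n i' j)) else 0)" if "i' \<in> {..<k}" for i'
  proof -
    have "(\<Sum>j'\<in>{1..<n}. int (c (hori n i' j')) * (\<psi> (head (hori n i' j')) - \<psi> (tail (hori n i' j'))))
      = (\<Sum>j'\<in>{1..<n}. if j' = j then (if i' < i then int (c (hori n i' j)) else 0) else 0)"
      using that assms by (intro sum.cong refl) (auto simp: \<psi>_def hori_def)
    then show ?thesis using assms by simp
  qed
  have columns: "(\<Sum>i'<k. \<Sum>j'\<in>{1..<n}. int (c (hori n i' j')) * (\<psi> (head (hori n i' j')) - \<psi> (tail (hori n i' j'))))
      = (\<Sum>i'<i. int (c (hori n i' j)))"
    using assms column by (intro sum.mono_neutral_cong_right) auto
  have "int (\<Sum>j'<j. c (vert n i j')) = int (\<Sum>i'<i. c (hori n i' j))"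
    using balance \<open>\<psi> (0, 1) = 0\<close> \<open>\<psi> (1, 1) = 0\<close> rows columns
    by (simp add: sum.inner_arrows[OF assms(1,2)])
  then show ?thesis by (simp only: of_nat_eq_iff)
qed

lemma sum_by_parts:
  fixes f g :: "nat \<Rightarrow> 'a::comm_ring"
  assumes "n \<ge> 1"
  shows "(\<Sum>j<n. (f (j + 1) - f j) * g j) = f n * g (n - 1) - f 0 * g 0 - (\<Sum>j\<in>{1..<n}. f j * (g j - g (j - 1)))"
  using assms
proof (induction n rule: nat_induct_at_least)
  case base
  then show ?case by (simp add: algebra_simps)
next
  case (Suc n)
  then show ?case by (simp add: algebra_simps)
qed

text \<open>
  Differences of heights are balanced: after summation by parts in both directions the coefficient of
  an interior height \<open>t i j\<close> is the sum of the increments of \<open>\<phi>\<close> around the four sides of a face,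
  which is zero.  Only the boundary values remain.
\<close>
lemma grid_sum_by_parts:
  fixes t \<phi> :: "nat \<Rightarrow> nat \<Rightarrow> 'a::comm_ring"
  assumes "k \<ge> 1" "n \<ge> 1"
    and "\<And>i. i \<in> {1..<k} \<Longrightarrow> t i 0 = 0 \<and> t i n = r" and "\<And>j. j \<in> {1..<n} \<Longrightarrow> t 0 j = 0 \<and> t k j = r"
  shows "(\<Sum>i\<in>{1..<k}. \<Sum>j<n. (t i (j + 1) - t i j) * (\<phi> (i + 1) j - \<phi> i j)) +
    (\<Sum>i<k. \<Sum>j\<in>{1..<n}. (t (i + 1) j - t i j) * (\<phi> (i + 1) (j - 1) - \<phi> (i + 1) j))
    = r * (\<phi> k 0 - \<phi> 1 (n - 1))"
proof -
  have "(\<Sum>i\<in>{1..<k}. \<Sum>j<n. (t i (j + 1) - t i j) * (\<phi> (i + 1) j - \<phi> i j)) =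
      (\<Sum>i\<in>{1..<k}. r * (\<phi> (i + 1) (n - 1) - \<phi> i (n - 1)) -
        (\<Sum>j\<in>{1..<n}. t i j * ((\<phi> (i + 1) j - \<phi> i j) - (\<phi> (i + 1) (j - 1) - \<phi> i (j - 1)))))"
  proof (intro sum.cong refl)
    fix i assume "i \<in> {1..<k}"
    then show "(\<Sum>j<n. (t i (j + 1) - t i j) * (\<phi> (i + 1) j - \<phi> i j)) =
      r * (\<phi> (i + 1) (n - 1) - \<phi> i (n - 1)) -
        (\<Sum>j\<in>{1..<n}. t i j * ((\<phi> (i + 1) j - \<phi> i j) - (\<phi> (i + 1) (j - 1) - \<phi> i (j - 1))))"
      using assms(3) sum_by_parts[OF assms(2), of "t i" "\<lambda>j. \<phi> (i + 1) j - \<phi> i j"] by simp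
  qed
  also have "\<dots> = r * (\<phi> k (n - 1) - \<phi> 1 (n - 1)) - (\<Sum>i\<in>{1..<k}. \<Sum>j\<in>{1..<n}.
      t i j * ((\<phi> (i + 1) j - \<phi> i j) - (\<phi> (i + 1) (j - 1) - \<phi> i (j - 1))))"
    using sum_Suc_diff'[OF assms(1), of "\<lambda>i. \<phi> i (n - 1)"]
    by (simp add: sum_subtractf flip: sum_distrib_left)
  finally have V: "(\<Sum>i\<in>{1..<k}. \<Sum>j<n. (t i (j + 1) - t i j) * (\<phi> (i + 1) j - \<phi> i j)) = \<dots>" .
  have "(\<Sum>i<k. \<Sum>j\<in>{1..<n}. (t (i + 1) j - t i j) * (\<phi> (i + 1) (j - 1) - \<phi> (i + 1) j)) =
      (\<Sum>j\<in>{1..<n}. \<Sum>i<k. (t (i + 1) j - t i j) * (\<phi> (i + 1) (j - 1) - \<phi> (i + 1) j))"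
    by (rule sum.swap)
  also have "\<dots> = (\<Sum>j\<in>{1..<n}. r * (\<phi> k (j - 1) - \<phi> k j) - (\<Sum>i\<in>{1..<k}. t i j *
      ((\<phi> (i + 1) (j - 1) - \<phi> (i + 1) j) - (\<phi> i (j - 1) - \<phi> i j))))"
  proof (intro sum.cong refl)
    fix j assume "j \<in> {1..<n}"
    then show "(\<Sum>i<k. (t (i + 1) j - t i j) * (\<phi> (i + 1) (j - 1) - \<phi> (i + 1) j)) =
      r * (\<phi> k (j - 1) - \<phi> k j) - (\<Sum>i\<in>{1..<k}. t i j *
        ((\<phi> (i + 1) (j - 1) - \<phi> (i + 1) j) - (\<phi> i (j - 1) - \<phi> i j)))"
      using assms(1,4) sum_by_parts[OF assms(1), of "\<lambda>i. t i j" "\<lambda>i. \<phi> (i + 1) (j - 1) - \<phi> (i + 1) j"]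
      by simp
  qed
  also have "\<dots> = (\<Sum>j\<in>{1..<n}. r * (\<phi> k (j - 1) - \<phi> k j)) - (\<Sum>i\<in>{1..<k}. \<Sum>j\<in>{1..<n}. t i j *
      ((\<phi> (i + 1) (j - 1) - \<phi> (i + 1) j) - (\<phi> i (j - 1) - \<phi> i j)))"
    unfolding sum_subtractf by (subst sum.swap[of _ "{1..<k}"]) simp
  also have "(\<Sum>j\<in>{1..<n}. r * (\<phi> k (j - 1) - \<phi> k j)) = r * (\<phi> k 0 - \<phi> k (n - 1))"
    using assms(2) by (induction n rule: nat_induct_at_least) (auto simp: algebra_simps)
  finally have H: "(\<Sum>i<k. \<Sum>j\<in>{1..<n}. (t (i + 1) j - t i j) * (\<phi> (i + 1) (j - 1) - \<phi> (i + 1) j)) =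
    r * (\<phi> k 0 - \<phi> k (n - 1)) - (\<Sum>i\<in>{1..<k}. \<Sum>j\<in>{1..<n}. t i j *
      ((\<phi> (i + 1) (j - 1) - \<phi> (i + 1) j) - (\<phi> i (j - 1) - \<phi> i j)))" .
  have "(\<Sum>i\<in>{1..<k}. \<Sum>j\<in>{1..<n}. t i j * ((\<phi> (i + 1) (j - 1) - \<phi> (i + 1) j) - (\<phi> i (j - 1) - \<phi> i j)))
    = - (\<Sum>i\<in>{1..<k}. \<Sum>j\<in>{1..<n}. t i j * ((\<phi> (i + 1) j - \<phi> i j) - (\<phi> (i + 1) (j - 1) - \<phi> i (j - 1))))"
    unfolding sum_negf[symmetric] by (intro sum.cong refl) (simp add: algebra_simps)
  then show ?thesis unfolding V H by (simp add: algebra_simps)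
qed

text \<open>
  The heights of all faces, including the two unbounded ones: the region right of and above the
  grid has height \<open>0\<close>, the region left of and below it has height \<open>e\<close>.
\<close>
definition height :: "nat \<Rightarrow> nat \<Rightarrow> nat \<Rightarrow> (nat \<times> nat \<Rightarrow> nat) \<Rightarrow> nat \<Rightarrow> nat \<Rightarrow> nat" where
  "height k n e s i j = (if i = 0 \<or> j = 0 then 0 else s_ext k n e s i j)"

text \<open>
  The index tables with a non-zero summand in the \<open>I\<close>-series.
\<close>
definition tables :: "nat \<Rightarrow> nat \<Rightarrow> nat \<Rightarrow> (nat \<times> nat \<Rightarrow> nat) set" where
  "tables k n e = {s \<in> ({1..k-1} \<times> {1..n-1}) \<rightarrow>\<^sub>E UNIV.
     \<forall>i\<in>{1..k-1}. \<forall>j\<in>{1..n-1}. s_ext k n e s i j \<le> s_ext k n e s (i + 1) j \<and>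
       s_ext k n e s i j \<le> s_ext k n e s i (j + 1)}"

lemma height_mono:
  assumes "s \<in> tables k n e"
  shows "i < k \<Longrightarrow> 1 \<le> j \<Longrightarrow> j < n \<Longrightarrow> height k n e s i j \<le> height k n e s (i + 1) j"
    and "1 \<le> i \<Longrightarrow> i < k \<Longrightarrow> j < n \<Longrightarrow> height k n e s i j \<le> height k n e s i (j + 1)"
  using assms by (auto simp: tables_def height_def)

text \<open>
  Each arrow carries the height difference of the two faces that it separates; the arrow out of the
  source carries the full value.  The vertex \<open>(i, b)\<close> is translated to the reflected column
  \<open>n - b\<close>.
\<close>
definition table_flow :: "nat \<Rightarrow> nat \<Rightarrow> nat \<Rightarrow> (nat \<times> nat \<Rightarrow> nat) \<Rightarrow> arrow \<Rightarrow> nat" where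
  "table_flow k n e s \<alpha> =
     (let (i, b) = tail \<alpha>; t = height k n e s in
      if \<alpha> \<notin> inner_arrows k n then 0
      else if i = 0 then e
      else if fst (head \<alpha>) = i then t i (n - b) - t (i - 1) (n - b)
      else t i (n - b + 1) - t i (n - b))"

text \<open>
  The height at \<open>(i, j)\<close> is the amount of flow that leaves row \<open>i\<close> downwards in the last \<open>j\<close> columns.
\<close>
definition flow_table :: "nat \<Rightarrow> nat \<Rightarrow> (arrow \<Rightarrow> nat) \<Rightarrow> nat \<times> nat \<Rightarrow> nat" where
  "flow_table k n c = (\<lambda>(i, j)\<in>{1..k-1} \<times> {1..n-1}. \<Sum>j'<j. c (vert n i j'))"

lemma table_flow_values:
  assumes "k \<ge> 1" "n \<ge> 1"
  shows "table_flow k n e s ((0, 1), (1, 1)) = e"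
    and "1 \<le> i \<Longrightarrow> i < k \<Longrightarrow> j < n \<Longrightarrow>
      table_flow k n e s (vert n i j) = height k n e s i (j + 1) - height k n e s i j"
    and "i < k \<Longrightarrow> 1 \<le> j \<Longrightarrow> j < n \<Longrightarrow>
      table_flow k n e s (hori n i j) = height k n e s (i + 1) j - height k n e s i j"
proof -
  have "((0, 1), (1, 1)) \<in> inner_arrows k n" unfolding inner_arrows_eq[OF assms] by auto
  then show "table_flow k n e s ((0, 1), (1, 1)) = e" by (simp add: table_flow_def)
next
  assume "1 \<le> i" "i < k" "j < n"
  moreover from this have "vert n i j \<in> inner_arrows k n" unfolding inner_arrows_eq[OF assms] by force
  ultimately show "table_flow k n e s (vert n i j) = height k n e s i (j + 1) - height k n e s i j"
    by (simp add: table_flow_def) (simp add: vert_def Let_def)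
next
  assume "i < k" "1 \<le> j" "j < n"
  moreover from this have "hori n i j \<in> inner_arrows k n" unfolding inner_arrows_eq[OF assms] by force
  ultimately show "table_flow k n e s (hori n i j) = height k n e s (i + 1) j - height k n e s i j"
    by (simp add: table_flow_def) (simp add: hori_def Let_def)
qed

lemma height_boundary:
  shows "height k n e s i 0 = 0" "height k n e s 0 j = 0"
    and "j \<ge> 1 \<Longrightarrow> k \<ge> 1 \<Longrightarrow> height k n e s k j = e" "i \<ge> 1 \<Longrightarrow> n \<ge> 1 \<Longrightarrow> height k n e s i n = e"
  by (auto simp: height_def s_ext_def)

lemma table_flow_in_flows:
  assumes "k \<ge> 1" "n \<ge> 1" "s \<in> tables k n e"
  shows "table_flow k n e s \<in> flows k n e"
proof -
  let ?c = "table_flow k n e s" and ?t = "\<lambda>i j. int (height k n e s i j)"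
  have "int e * \<psi> (0, 1) + (\<Sum>\<alpha>\<in>inner_arrows k n. int (?c \<alpha>) * (\<psi> (head \<alpha>) - \<psi> (tail \<alpha>))) = 0"
    if "\<psi> (k, n) = 0" for \<psi> :: "vertex \<Rightarrow> int"
  proof -
    define \<phi> where "\<phi> i j = \<psi> (i, n - j)" for i j
    have "(\<Sum>i\<in>{1..<k}. \<Sum>j<n. int (?c (vert n i j)) * (\<psi> (head (vert n i j)) - \<psi> (tail (vert n i j))))
        = (\<Sum>i\<in>{1..<k}. \<Sum>j<n. (?t i (j + 1) - ?t i j) * (\<phi> (i + 1) j - \<phi> i j))"
    proof (intro sum.cong refl)
      fix i j assume ij: "i \<in> {1..<k}" "j \<in> {..<n}"
      have "\<psi> (head (vert n i j)) - \<psi> (tail (vert n i j)) = \<phi> (i + 1) j - \<phi> i j"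
        by (simp add: \<phi>_def vert_def)
      with ij height_mono(2)[OF assms(3), of i j]
      show "int (?c (vert n i j)) * (\<psi> (head (vert n i j)) - \<psi> (tail (vert n i j)))
        = (?t i (j + 1) - ?t i j) * (\<phi> (i + 1) j - \<phi> i j)"
        by (simp add: table_flow_values[OF assms(1,2)] of_nat_diff)
    qed
    moreover have "(\<Sum>i<k. \<Sum>j\<in>{1..<n}. int (?c (hori n i j)) * (\<psi> (head (hori n i j)) - \<psi> (tail (hori n i j))))
        = (\<Sum>i<k. \<Sum>j\<in>{1..<n}. (?t (i + 1) j - ?t i j) * (\<phi> (i + 1) (j - 1) - \<phi> (i + 1) j))"
    proof (intro sum.cong refl)
      fix i j assume ij: "i \<in> {..<k}" "j \<in> {1..<n}"
      then have "n - (j - 1) = n - j + 1" by auto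
      then have "\<psi> (head (hori n i j)) - \<psi> (tail (hori n i j)) = \<phi> (i + 1) (j - 1) - \<phi> (i + 1) j"
        by (simp add: \<phi>_def hori_def)
      with ij height_mono(1)[OF assms(3), of i j]
      show "int (?c (hori n i j)) * (\<psi> (head (hori n i j)) - \<psi> (tail (hori n i j)))
        = (?t (i + 1) j - ?t i j) * (\<phi> (i + 1) (j - 1) - \<phi> (i + 1) j)"
        by (simp add: table_flow_values[OF assms(1,2)] of_nat_diff)
    qed
    moreover have "(\<Sum>i\<in>{1..<k}. \<Sum>j<n. (?t i (j + 1) - ?t i j) * (\<phi> (i + 1) j - \<phi> i j)) +
        (\<Sum>i<k. \<Sum>j\<in>{1..<n}. (?t (i + 1) j - ?t i j) * (\<phi> (i + 1) (j - 1) - \<phi> (i + 1) j))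
        = int e * (\<phi> k 0 - \<phi> 1 (n - 1))"
      using assms(1,2) by (intro grid_sum_by_parts) (auto simp: height_boundary)
    moreover have "\<phi> k 0 = 0" "\<phi> 1 (n - 1) = \<psi> (1, 1)"
      using that assms(2) by (auto simp: \<phi>_def)
    ultimately show ?thesis
      by (simp add: sum.inner_arrows[OF assms(1,2)] table_flow_values(1)[OF assms(1,2), simplified] algebra_simps)
  qed
  then show ?thesis by (auto simp: flows_def table_flow_def)
qed

text \<open>
  The two descriptions of the height, by vertical and by horizontal arrows, agree at interior faces by
  planarity, and at boundary faces because every level carries the full flow \<open>r\<close>.
\<close>
lemma height_flow_table:
  assumes "k \<ge> 1" "n \<ge> 1" "c \<in> flows k n r"
  shows "1 \<le> i \<Longrightarrow> i < k \<Longrightarrow> j \<le> n \<Longrightarrow> height k n r (flow_table k n c) i j = (\<Sum>j'<j. c (vert n i j'))"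
    and "i \<le> k \<Longrightarrow> 1 \<le> j \<Longrightarrow> j < n \<Longrightarrow> height k n r (flow_table k n c) i j = (\<Sum>i'<i. c (hori n i' j))"
proof -
  have inner: "height k n r (flow_table k n c) i j = (\<Sum>j'<j. c (vert n i j'))"
    if "1 \<le> i" "i < k" "1 \<le> j" "j < n" for i j
    using that by (auto simp: height_def s_ext_def flow_table_def)
  have row: "(\<Sum>j'<n. c (vert n i j')) = r" if "1 \<le> i" "i < k" for i
  proof -
    have "inj_on (vert n i) {..<n}" by (auto simp: inj_on_def vert_def)
    then have "(\<Sum>j'<n. c (vert n i j')) = sum c (E_set k n (i + 1))"
      unfolding E_set_vert[OF assms(1,2) that] by (simp add: sum.reindex)
    also have "\<dots> = r" using that assms by (intro flow_through_level) auto
    finally show ?thesis .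
  qed
  have column: "(\<Sum>i'<k. c (hori n i' j)) = r" if "1 \<le> j" "j < n" for j
  proof -
    have "inj_on (\<lambda>i. hori n i j) {..<k}" by (auto simp: inj_on_def hori_def)
    then have "(\<Sum>i'<k. c (hori n i' j)) = sum c (E_set k n (k + n - j))"
      unfolding E_set_hori[OF assms(1) that] by (simp add: sum.reindex)
    also have "\<dots> = r" using that assms by (intro flow_through_level) auto
    finally show ?thesis .
  qed
  show "height k n r (flow_table k n c) i j = (\<Sum>j'<j. c (vert n i j'))" if "1 \<le> i" "i < k" "j \<le> n"
    using that inner row assms(2)
    by (cases "j = 0"; cases "j = n") (auto simp: height_boundary)
  show "height k n r (flow_table k n c) i j = (\<Sum>i'<i. c (hori n i' j))" if "i \<le> k" "1 \<le> j" "j < n"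
    using that inner column assms flow_through_corner[OF assms, of i j]
    by (cases "i = 0"; cases "i = k") (auto simp: height_boundary)
qed

lemma flow_table_in_tables:
  assumes "k \<ge> 1" "n \<ge> 1" "c \<in> flows k n r"
  shows "flow_table k n c \<in> tables k n r"
proof -
  have "s_ext k n r (flow_table k n c) i j \<le> s_ext k n r (flow_table k n c) (i + 1) j \<and>
      s_ext k n r (flow_table k n c) i j \<le> s_ext k n r (flow_table k n c) i (j + 1)"
    if "i \<in> {1..k-1}" "j \<in> {1..n-1}" for i j
  proof -
    have ij: "1 \<le> i" "i < k" "1 \<le> j" "j < n" using that by auto
    then have "height k n r (flow_table k n c) i j \<le> height k n r (flow_table k n c) (i + 1) j"
      using height_flow_table(2)[OF assms] by simp
    moreover have "height k n r (flow_table k n c) i j \<le> height k n r (flow_table k n c) i (j + 1)"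
      using ij height_flow_table(1)[OF assms] by simp
    ultimately show ?thesis using ij by (simp add: height_def)
  qed
  then show ?thesis by (auto simp: tables_def flow_table_def)
qed

lemma table_flow_flow_table:
  assumes "k \<ge> 1" "n \<ge> 1" "c \<in> flows k n r"
  shows "table_flow k n r (flow_table k n c) = c"
proof
  fix \<alpha>
  have first: "c ((0, 1), (1, 1)) = r"
    using flow_through_level[OF assms, of 1] assms(1,2) by (simp add: E_set_first del: One_nat_def)
  have v: "table_flow k n r (flow_table k n c) (vert n i j) = c (vert n i j)" if "1 \<le> i" "i < k" "j < n" for i j
    using that by (simp add: table_flow_values[OF assms(1,2)] height_flow_table(1)[OF assms])
  have h: "table_flow k n r (flow_table k n c) (hori n i j) = c (hori n i j)" if "i < k" "1 \<le> j" "j < n" for i j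
    using that by (simp add: table_flow_values[OF assms(1,2)] height_flow_table(2)[OF assms])
  show "table_flow k n r (flow_table k n c) \<alpha> = c \<alpha>"
  proof (cases "\<alpha> \<in> inner_arrows k n")
    case True
    with first v h table_flow_values(1)[OF assms(1,2)] show ?thesis
      unfolding inner_arrows_eq[OF assms(1,2)] by auto
  next
    case False
    moreover have "c \<alpha> = 0" using False assms(3) unfolding flows_def by blast
    ultimately show ?thesis by (simp add: table_flow_def)
  qed
qed

lemma flow_table_table_flow:
  assumes "k \<ge> 1" "n \<ge> 1" "s \<in> tables k n e"
  shows "flow_table k n (table_flow k n e s) = s"
proof
  fix p :: "nat \<times> nat"
  obtain i j where p: "p = (i, j)" by (cases p)
  show "flow_table k n (table_flow k n e s) p = s p"
  proof (cases "p \<in> {1..k-1} \<times> {1..n-1}")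
    case True
    then have i: "1 \<le> i" "i < k" and j: "1 \<le> j" "j < n" by (auto simp: p)
    have "(\<Sum>j'<m. table_flow k n e s (vert n i j')) = height k n e s i m" if "m \<le> n" for m
      using that height_mono(2)[OF assms(3) i]
      by (induction m) (auto simp: height_boundary table_flow_values(2)[OF assms(1,2) i])
    from this[of j] i j True show ?thesis
      by (simp add: p flow_table_def height_def s_ext_def)
  next
    case False
    have "s \<in> ({1..k-1} \<times> {1..n-1}) \<rightarrow>\<^sub>E UNIV"
      using assms(3) by (simp add: tables_def)
    then have "s p = undefined" using False by (rule PiE_arb)
    then show ?thesis unfolding flow_table_def restrict_def if_not_P[OF False] by (rule sym)
  qed
qed

section \<open>Weights of flows and the coefficients of the series\<close>
text \<open>
  The multinomial coefficient of the increments of a chain \<open>0 = t 0 \<le> t 1 \<le> \<dots> \<le> t k\<close>, written as an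
  iterated binomial coefficient.
\<close>
lemma prod_binomial_chain:
  fixes t :: "nat \<Rightarrow> nat"
  assumes "k \<ge> 1" "t 0 = 0" "\<And>i. i < k \<Longrightarrow> t i \<le> t (i + 1)"
  shows "(\<Prod>i\<in>{1..<k}. t (i + 1) choose t i) * (\<Prod>i<k. fact (t (i + 1) - t i)) = (fact (t k) :: nat)"
  using assms(1,3)
proof (induction k rule: nat_induct_at_least)
  case base
  then show ?case using assms(2) by simp
next
  case (Suc k)
  have "(\<Prod>i\<in>{1..<Suc k}. t (i + 1) choose t i) * (\<Prod>i<Suc k. fact (t (i + 1) - t i))
      = fact (t k) * fact (t (k + 1) - t k) * (t (k + 1) choose t k)"
    using Suc by (simp add: mult_ac flip: Suc.IH)
  also have "\<dots> = fact (t (Suc k))"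
    using Suc.prems[of k] by (simp add: binomial_fact_lemma)
  finally show ?case .
qed

text \<open>
  Each of the \<open>n - 1\<close> columns and \<open>k - 1\<close> rows of heights is a chain from \<open>0\<close> to \<open>e\<close>; its binomial
  coefficients cancel the factorials of its increments up to \<open>fact e\<close>.  One more factor \<open>fact e\<close> comes
  from the arrow out of the source.
\<close>
lemma table_weight:
  assumes "k \<ge> 1" "n \<ge> 1" "s \<in> tables k n e"
  shows "(\<Prod>i=1..k-1. \<Prod>j=1..n-1. (s_ext k n e s (i + 1) j choose s_ext k n e s i j) *
      (s_ext k n e s i (j + 1) choose s_ext k n e s i j)) *
    (\<Prod>\<alpha>\<in>inner_arrows k n. fact (table_flow k n e s \<alpha>)) = (fact e ^ (k + n - 1) :: nat)"
proof -
  let ?t = "height k n e s"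
  have cols: "(\<Prod>i\<in>{1..<k}. ?t (i + 1) j choose ?t i j) * (\<Prod>i<k. fact (?t (i + 1) j - ?t i j)) = (fact e :: nat)"
    if "j \<in> {1..<n}" for j
    using prod_binomial_chain[of k "\<lambda>i. ?t i j"] height_mono(1)[OF assms(3), of _ j] assms(1) that
    by (simp add: height_boundary)
  have rows: "(\<Prod>j\<in>{1..<n}. ?t i (j + 1) choose ?t i j) * (\<Prod>j<n. fact (?t i (j + 1) - ?t i j)) = (fact e :: nat)"
    if "i \<in> {1..<k}" for i
    using prod_binomial_chain[of n "\<lambda>j. ?t i j"] height_mono(2)[OF assms(3), of i] assms(2) that
    by (simp add: height_boundary)
  have "{1..k-1} = {1..<k}" "{1..n-1} = {1..<n}" using assms by auto
  then have "(\<Prod>i=1..k-1. \<Prod>j=1..n-1. (s_ext k n e s (i + 1) j choose s_ext k n e s i j) *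
      (s_ext k n e s i (j + 1) choose s_ext k n e s i j)) =
    (\<Prod>i\<in>{1..<k}. \<Prod>j\<in>{1..<n}. (?t (i + 1) j choose ?t i j) * (?t i (j + 1) choose ?t i j))"
    by (intro prod.cong) (auto simp: height_def)
  also have "\<dots> = (\<Prod>j\<in>{1..<n}. \<Prod>i\<in>{1..<k}. ?t (i + 1) j choose ?t i j) *
      (\<Prod>i\<in>{1..<k}. \<Prod>j\<in>{1..<n}. ?t i (j + 1) choose ?t i j)"
    unfolding prod.distrib by (subst prod.swap) simp
  finally have 1: "(\<Prod>i=1..k-1. \<Prod>j=1..n-1. (s_ext k n e s (i + 1) j choose s_ext k n e s i j) *
      (s_ext k n e s i (j + 1) choose s_ext k n e s i j)) = \<dots>" .
  have "(\<Prod>\<alpha>\<in>inner_arrows k n. fact (table_flow k n e s \<alpha>)) = (fact e *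
      ((\<Prod>i\<in>{1..<k}. \<Prod>j<n. fact (?t i (j + 1) - ?t i j)) *
       (\<Prod>j\<in>{1..<n}. \<Prod>i<k. fact (?t (i + 1) j - ?t i j))) :: nat)"
    unfolding prod.inner_arrows[OF assms(1,2)]
    by (subst (4) prod.swap, intro arg_cong2[where f = times] prod.cong refl)
       (auto simp: table_flow_values[OF assms(1,2), simplified])
  with 1 have "?thesis \<longleftrightarrow> fact e *
      (\<Prod>j\<in>{1..<n}. (\<Prod>i\<in>{1..<k}. ?t (i + 1) j choose ?t i j) * (\<Prod>i<k. fact (?t (i + 1) j - ?t i j))) *
      (\<Prod>i\<in>{1..<k}. (\<Prod>j\<in>{1..<n}. ?t i (j + 1) choose ?t i j) * (\<Prod>j<n. fact (?t i (j + 1) - ?t i j)))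
      = (fact e ^ (k + n - 1) :: nat)"
    by (simp add: prod.distrib mult_ac)
  moreover have "fact e * (\<Prod>j\<in>{1..<n}. fact e) * (\<Prod>i\<in>{1..<k}. fact e) = (fact e ^ (k + n - 1) :: nat)"
    using assms(1,2) by (simp flip: power_Suc power_add) (simp add: add.commute)
  moreover have "(\<Prod>j\<in>{1..<n}. (\<Prod>i\<in>{1..<k}. ?t (i + 1) j choose ?t i j) *
      (\<Prod>i<k. fact (?t (i + 1) j - ?t i j))) = (\<Prod>j\<in>{1..<n}. fact e :: nat)"
    by (intro prod.cong refl cols)
  moreover have "(\<Prod>i\<in>{1..<k}. (\<Prod>j\<in>{1..<n}. ?t i (j + 1) choose ?t i j) *
      (\<Prod>j<n. fact (?t i (j + 1) - ?t i j))) = (\<Prod>i\<in>{1..<k}. fact e :: nat)"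
    by (intro prod.cong refl rows)
  ultimately show ?thesis by simp
qed

text \<open>
  Summands outside \<open>tables k n e\<close> vanish because one of their binomial coefficients does, and tables
  correspond bijectively to flows with matching weights.
\<close>
lemma I_coeff_eq_sum_flows:
  assumes "k \<ge> 1" "n \<ge> 1"
  shows "I_coeff k n l d e = (\<Prod>i=0..l. fact (d i * e)) / fact e *
    (\<Sum>c\<in>flows k n e. 1 / (\<Prod>\<alpha>\<in>inner_arrows k n. fact (c \<alpha>)))"
proof -
  let ?C = "(\<Prod>i=0..l. fact (d i * e)) :: complex"
  let ?P = "\<lambda>s. \<Prod>i=1..k-1. \<Prod>j=1..n-1. (s_ext k n e s (i + 1) j choose s_ext k n e s i j) *
      (s_ext k n e s i (j + 1) choose s_ext k n e s i j)"
  have bij: "bij_betw (table_flow k n e) (tables k n e) (flows k n e)"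
    by (rule bij_betw_byWitness[where f' = "flow_table k n"])
       (auto simp: flow_table_table_flow[OF assms] table_flow_flow_table[OF assms]
          table_flow_in_flows[OF assms] flow_table_in_tables[OF assms])
  have fin: "finite (tables k n e)"
    using bij_betw_finite[OF bij] finite_flows[OF assms] by blast
  have "I_coeff k n l d e = (\<Sum>\<^sub>\<infinity>s\<in>({1..k-1} \<times> {1..n-1}) \<rightarrow>\<^sub>E UNIV. ?C / fact e ^ (k + n) * of_nat (?P s))"
    by (simp add: I_coeff_def)
  also have "\<dots> = (\<Sum>\<^sub>\<infinity>s\<in>tables k n e. ?C / fact e ^ (k + n) * of_nat (?P s))"
  proof (rule infsum_cong_neutral)
    fix s assume "s \<in> (({1..k-1} \<times> {1..n-1}) \<rightarrow>\<^sub>E UNIV) - tables k n e"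
    then obtain i j where ij: "i \<in> {1..k-1}" "j \<in> {1..n-1}" and
      "\<not> (s_ext k n e s i j \<le> s_ext k n e s (i + 1) j \<and> s_ext k n e s i j \<le> s_ext k n e s i (j + 1))"
      by (auto simp: tables_def)
    then have "(s_ext k n e s (i + 1) j choose s_ext k n e s i j) *
      (s_ext k n e s i (j + 1) choose s_ext k n e s i j) = 0"
      by (auto simp: binomial_eq_0_iff not_le)
    with ij have "?P s = 0"
      by (intro prod_zero bexI[of _ i] bexI[of _ j]) auto
    then show "?C / fact e ^ (k + n) * of_nat (?P s) = 0" by simp
  qed (auto simp: tables_def)
  also have "\<dots> = (\<Sum>s\<in>tables k n e. ?C / fact e * (1 / (\<Prod>\<alpha>\<in>inner_arrows k n. fact (table_flow k n e s \<alpha>))))"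
  proof (subst infsum_finite[OF fin], intro sum.cong refl)
    fix s assume s: "s \<in> tables k n e"
    let ?w = "(\<Prod>\<alpha>\<in>inner_arrows k n. fact (table_flow k n e s \<alpha>)) :: complex"
    have "of_nat (?P s) * ?w = fact e ^ (k + n - 1)"
      using arg_cong[OF table_weight[OF assms s], of "of_nat :: nat \<Rightarrow> complex"] by (simp add: of_nat_prod)
    moreover have "?w \<noteq> 0" by (simp add: finite_inner_arrows)
    ultimately have "of_nat (?P s) = fact e ^ (k + n - 1) / ?w" by (simp add: field_simps)
    moreover have "(fact e ^ (k + n) :: complex) = fact e * fact e ^ (k + n - 1)"
      using assms by (simp flip: power_Suc)
    ultimately show "?C / fact e ^ (k + n) * of_nat (?P s) = ?C / fact e * (1 / ?w)"
      by simp
  qed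
  also have "\<dots> = (\<Sum>c\<in>flows k n e. ?C / fact e * (1 / (\<Prod>\<alpha>\<in>inner_arrows k n. fact (c \<alpha>))))"
    by (rule sum.reindex_bij_betw[OF bij])
  finally show ?thesis by (simp add: sum_distrib_left)
qed

section \<open>The Laurent polynomial and its constant terms\<close>

lemma keys_arrow_expo:
  assumes "\<alpha> \<in> arrows k n" "k \<ge> 1" "n \<ge> 1"
  shows "Poly_Mapping.keys (arrow_expo k n \<alpha>) \<subseteq> variables k n"
proof -
  have "Poly_Mapping.keys (vertex_expo k n v) \<subseteq> variables k n"
    if "v \<in> {(k, n), (k, n + 1)} \<union> variables k n" for v
    using that by (auto simp: vertex_expo_def variables_def)
  moreover have "tail \<alpha> \<in> {(k, n), (k, n + 1)} \<union> variables k n" "head \<alpha> \<in> {(k, n), (k, n + 1)} \<union> variables k n"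
    using assms by (cases rule: arrow_cases; auto simp: variables_def)+
  ultimately show ?thesis
    using keys_diff[of "vertex_expo k n (head \<alpha>)" "vertex_expo k n (tail \<alpha>)"]
    unfolding arrow_expo_def by blast
qed

lemma set_to_one_F_sum:
  "set_to_one W (F_sum k n S) = (\<Sum>\<alpha>\<in>S. Poly_Mapping.single (set_to_one_expo W (arrow_expo k n \<alpha>)) 1)"
  by (simp add: F_sum_def set_to_one_sum set_to_one_single arrow_expo_def)

lemma laurent_in_f_Y:
  assumes "k \<ge> 1" "n \<ge> 1"
  shows "laurent_in (variables k n - weight_variables k l d) (f_Y k n l d)"
proof -
  let ?W = "weight_variables k l d" and ?V = "variables k n - weight_variables k l d"
  have expo: "Poly_Mapping.keys (set_to_one_expo ?W e) \<subseteq> ?V" if "Poly_Mapping.keys e \<subseteq> variables k n" for e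
  proof
    fix v assume "v \<in> Poly_Mapping.keys (set_to_one_expo ?W e)"
    then show "v \<in> ?V" using that by (auto simp: in_keys_iff lookup_set_to_one_expo split: if_splits)
  qed
  have F: "laurent_in ?V (set_to_one ?W (F_sum k n S))" if "S \<subseteq> arrows k n" for S
    unfolding set_to_one_F_sum
    using that by (intro laurent_in_sum laurent_in_single expo keys_arrow_expo[OF _ assms]) auto
  have a: "laurent_in ?V (set_to_one ?W a_var)"
    unfolding a_var_def set_to_one_single
    by (intro laurent_in_single expo) (simp add: variables_def)
  show ?thesis
    unfolding f_Y_def Let_def
    by (intro laurent_in_add laurent_in_mult laurent_in_prod laurent_in_power F a)
       (auto simp: A_set_level[OF assms] block_level[OF assms] inner_arrows_def)
qed

lemma card_reduced_variables:
  assumes "\<And>i. i \<in> {1..l} \<Longrightarrow> d i \<ge> 1" "u_sum d l < k + n" "k \<ge> 1" "n \<ge> 1"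
  shows "card (variables k n - weight_variables k l d) = n * k - l"
proof -
  have "card (variables k n) = n * k"
    using assms(3,4) by (simp add: variables_def card_cartesian_product mult.commute)
  moreover have "card (weight_variables k l d) = l"
    unfolding weight_variables_def by (subst card_image[OF inj_on_weight_vertex[OF assms(1)]]) auto
  moreover have "finite (weight_variables k l d)" by (simp add: weight_variables_def)
  moreover have "weight_variables k l d \<subseteq> variables k n"
    by (rule weight_variables_subset[OF assms])
  ultimately show ?thesis by (simp add: card_Diff_subset)
qed

lemma sum_part:
  fixes c :: "arrow \<Rightarrow> nat"
  assumes "k \<ge> 1" "n \<ge> 1" "u_sum d l < k + n" "p \<le> l"
  shows "sum c (parts k n l d p) = (\<Sum>q\<in>(if p = 0 then {u_sum d l + 1..<k + n}
    else {u_sum d (p - 1) + 1..u_sum d p}). sum c (E_set k n q))" (is "_ = sum _ ?Q")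
proof -
  have "parts k n l d p = {\<alpha> \<in> arrows k n. level k \<alpha> \<in> ?Q}"
    using level_bounds[OF _ assms(1,2)]
    by (auto simp: parts_def A_set_level[OF assms(1,2)] block_level[OF assms(1,2)] inner_arrows_level[OF assms(1,2)])
  moreover have "?Q \<inter> {1..k+n} = ?Q"
    using u_sum_mono[of p l d] assms(3,4) by auto
  ultimately show ?thesis using sum_levels[OF assms(1,2), of c ?Q] by simp
qed

text \<open>
  Setting the weight variables to \<open>1\<close> creates no contributions to the constant term beyond the flows:
  the prescribed total over each block says that the total monomial has degree \<open>0\<close> for that block, so if
  its image is trivial, it is a monomial in the weight variables of degree \<open>0\<close> in all gradings.  A flow in
  turn meets each level exactly \<open>r\<close> times.  This determines the totals over the blocks, and the total
  over \<open>A_set k n l d\<close>, which consists of \<open>d 0 - 1\<close> levels, is \<open>m - r\<close> iff \<open>m = d 0 * r\<close>.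
\<close>
lemma reduced_balance_iff_flow:
  fixes c :: "arrow \<Rightarrow> nat"
  assumes d: "\<And>i. i \<in> {1..l} \<Longrightarrow> d i \<ge> 1" and kn: "k \<ge> 1" "n \<ge> 1"
    and d0: "u_sum d l + d 0 = k + n" "d 0 > 0" and r: "r \<le> m"
  shows "c \<in> exponent_counts {0..l} (parts k n l d) (\<lambda>p. if p = 0 then m - r else d p * r) \<and>
      set_to_one_expo (weight_variables k l d) (total_expo k n r c) = 0 \<longleftrightarrow>
    c \<in> flows k n r \<and> d 0 * r = m"
proof -
  let ?N = "\<lambda>p. if p = 0 then m - r else d p * r"
  let ?W = "weight_variables k l d"
  have bound: "u_sum d l < k + n" using d0 by linarith
  note part = parts_partition[OF kn bound]
  have block_sum: "(\<Sum>q\<in>{u_sum d (p - 1) + 1..u_sum d p}. r) = d p * r" if "p \<in> {1..l}" for p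
    using that u_sum_Suc[of d "p - 1"] by simp
  \<comment> \<open>The extra \<open>r\<close> stands for the level \<open>k + n\<close> of the last arrow, which \<open>A_set\<close> omits.\<close>
  have A_sum: "(\<Sum>q\<in>{u_sum d l + 1..<k + n}. r) + r = d 0 * r"
  proof -
    have "d 0 = Suc (k + n - (u_sum d l + 1))" using d0 by linarith
    then show ?thesis by simp
  qed
  have flow_part: "sum c (parts k n l d p) = (\<Sum>q\<in>(if p = 0 then {u_sum d l + 1..<k + n}
    else {u_sum d (p - 1) + 1..u_sum d p}). r)" if "p \<le> l" "c \<in> flows k n r" for p
    unfolding sum_part[OF kn bound that(1)]
    using that(1) u_sum_mono[of p l d] bound
    by (intro sum.cong refl flow_through_level[OF kn that(2)]) (auto split: if_splits)
  show ?thesis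
  proof (intro iffI conjI; elim conjE)
    assume c: "c \<in> exponent_counts {0..l} (parts k n l d) ?N"
      and zero: "set_to_one_expo ?W (total_expo k n r c) = 0"
    have "total_expo k n r c = 0"
    proof (rule weight_expo_eq_zero[OF d bound kn])
      fix v assume "v \<notin> ?W"
      then show "Poly_Mapping.lookup (total_expo k n r c) v = 0"
        using lookup_set_to_one_expo[of ?W "total_expo k n r c" v] zero by simp
    next
      fix p assume p: "p \<in> {1..l}"
      let ?Q = "{u_sum d (p - 1) + 1..u_sum d p}"
      have "(\<Sum>v\<in>variables k n. (\<Sum>q\<in>?Q. - of_bool (before_level k q v)) *
            Poly_Mapping.lookup (total_expo k n r c) v)
          = (\<Sum>q\<in>?Q. \<Sum>v\<in>variables k n. - of_bool (before_level k q v) *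
            Poly_Mapping.lookup (total_expo k n r c) v)"
        unfolding sum_distrib_right by (rule sum.swap)
      also have "\<dots> = (\<Sum>q\<in>?Q. int (sum c (E_set k n q)) - int r)"
      proof (intro sum.cong refl)
        fix q assume "q \<in> ?Q"
        then have q: "q \<ge> 1" "q < k + n" using p u_sum_mono[of p l d] bound by auto
        then have "- of_bool (before_level k q (k, n)) = (0 :: int)" by (auto simp: before_level_def)
        note total_expo_pairing[where \<psi> = "\<lambda>v. - of_bool (before_level k q v)" and r = r and c = c, OF this kn]
        also note potential_level[OF kn q]
        finally show "(\<Sum>v\<in>variables k n. - of_bool (before_level k q v) *
            Poly_Mapping.lookup (total_expo k n r c) v) = int (sum c (E_set k n q)) - int r" .
      qed
      also have "\<dots> = int (sum c (parts k n l d p)) - int (\<Sum>q\<in>?Q. r)"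
        using p by (simp add: sum_part[OF kn bound] sum_subtractf)
      also have "\<dots> = 0"
        using c p block_sum[OF p] by (auto simp: exponent_counts_def)
      finally show "(\<Sum>v\<in>variables k n. (\<Sum>q\<in>?Q. - of_bool (before_level k q v)) *
            Poly_Mapping.lookup (total_expo k n r c) v) = 0" .
    qed
    moreover have "\<forall>\<alpha>. \<alpha> \<notin> inner_arrows k n \<longrightarrow> c \<alpha> = 0"
      using c unfolding exponent_counts_def part(2) by blast
    ultimately show flow: "c \<in> flows k n r"
      by (simp add: flows_iff_total_expo[OF kn])
    have "m - r = sum c (parts k n l d 0)" using c by (simp add: exponent_counts_def)
    then show "d 0 * r = m" using flow_part[OF _ flow, of 0] A_sum r by simp
  next
    assume flow: "c \<in> flows k n r" and m: "d 0 * r = m"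
    have "sum c (parts k n l d p) = ?N p" if "p \<in> {0..l}" for p
      using that flow_part[OF _ flow, of p] A_sum m block_sum[of p] by (cases "p = 0") auto
    moreover have "\<forall>\<alpha>. \<alpha> \<notin> inner_arrows k n \<longrightarrow> c \<alpha> = 0"
      using flow unfolding flows_def by blast
    ultimately show "c \<in> exponent_counts {0..l} (parts k n l d) ?N"
      unfolding exponent_counts_def part(2) by blast
    have "total_expo k n r c = 0" using flow by (simp add: flows_iff_total_expo[OF kn])
    then show "set_to_one_expo ?W (total_expo k n r c) = 0"
      by (intro poly_mapping_eqI) (simp add: lookup_set_to_one_expo)
  qed
qed

lemma constant_term_f_Y_power:
  assumes d: "\<And>i. i \<in> {1..l} \<Longrightarrow> d i \<ge> 1" and kn: "k \<ge> 1" "n \<ge> 1"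
    and d0: "u_sum d l + d 0 = k + n" "d 0 > 0"
  shows "constant_term (f_Y k n l d ^ m) = (\<Sum>r | d 0 * r = m. I_coeff k n l d r)"
proof -
  let ?\<pi> = "set_to_one_expo (weight_variables k l d)"
  let ?B = "parts k n l d"
  let ?N = "\<lambda>r p. if p = 0 then m - r else d p * r"
  let ?w = "\<lambda>c. (\<Prod>\<alpha>\<in>inner_arrows k n. fact (c \<alpha>)) :: complex"
  have bound: "u_sum d l < k + n" using d0 by linarith
  note part = parts_partition[OF kn bound]
  have f: "f_Y k n l d = (\<Sum>\<alpha>\<in>?B 0. Poly_Mapping.single (?\<pi> (arrow_expo k n \<alpha>)) 1) +
      Poly_Mapping.single (?\<pi> (Poly_Mapping.single (0, 1) 1)) 1 *
      (\<Prod>p=1..l. (\<Sum>\<alpha>\<in>?B p. Poly_Mapping.single (?\<pi> (arrow_expo k n \<alpha>)) 1) ^ d p)"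
    by (simp add: f_Y_def a_var_def set_to_one_single set_to_one_F_sum parts_def)
  have total: "frag_cmul (int r) (?\<pi> (Poly_Mapping.single (0, 1) 1)) +
      (\<Sum>\<alpha>\<in>inner_arrows k n. frag_cmul (int (c \<alpha>)) (?\<pi> (arrow_expo k n \<alpha>))) = ?\<pi> (total_expo k n r c)" for r c
    by (intro poly_mapping_eqI) (simp add: total_expo_def lookup_add lookup_sum lookup_set_to_one_expo)
  have "constant_term (f_Y k n l d ^ m) =
    (\<Sum>r\<le>m. \<Sum>c\<in>exponent_counts {0..l} ?B (?N r). if ?\<pi> (total_expo k n r c) = 0
       then of_nat (m choose r) * (\<Prod>p=0..l. fact (?N r p)) / ?w c else 0)"
    unfolding f by (subst constant_term_power_expansion) (simp_all only: part finite_parts[OF kn] total)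
  also have "\<dots> = (\<Sum>r\<le>m. if d 0 * r = m then I_coeff k n l d r else 0)"
  proof (intro sum.cong refl)
    fix r assume "r \<in> {..m}"
    then have r: "r \<le> m" by simp
    have "(\<Sum>c\<in>exponent_counts {0..l} ?B (?N r). if ?\<pi> (total_expo k n r c) = 0
        then of_nat (m choose r) * (\<Prod>p=0..l. fact (?N r p)) / ?w c else 0)
      = (\<Sum>c | c \<in> exponent_counts {0..l} ?B (?N r) \<and> ?\<pi> (total_expo k n r c) = 0.
          of_nat (m choose r) * (\<Prod>p=0..l. fact (?N r p)) / ?w c)"
      by (subst sum.inter_filter) (auto intro!: finite_exponent_counts finite_parts[OF kn])
    also have "\<dots> = (\<Sum>c | c \<in> flows k n r \<and> d 0 * r = m.
          of_nat (m choose r) * (\<Prod>p=0..l. fact (?N r p)) / ?w c)"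
      using reduced_balance_iff_flow[OF d kn d0 r] by (intro sum.cong) auto
    also have "\<dots> = (if d 0 * r = m then I_coeff k n l d r else 0)"
    proof (cases "d 0 * r = m")
      case True
      have "(\<Prod>p=0..l. fact (?N r p)) = fact (m - r) * (\<Prod>p=1..l. fact (d p * r) :: complex)"
        by (subst prod.atLeast_Suc_atMost) (auto intro!: prod.cong)
      moreover have "(\<Prod>p=0..l. fact (d p * r)) = fact m * (\<Prod>p=1..l. fact (d p * r) :: complex)"
        by (subst prod.atLeast_Suc_atMost) (auto simp: True)
      ultimately have "of_nat (m choose r) * (\<Prod>p=0..l. fact (?N r p)) =
          (\<Prod>p=0..l. fact (d p * r)) / (fact r :: complex)"
        using r by (simp add: binomial_fact divide_simps)
      then show ?thesis
        using True by (simp add: I_coeff_eq_sum_flows[OF kn] sum_distrib_left)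
    qed simp
    finally show "(\<Sum>c\<in>exponent_counts {0..l} ?B (?N r). if ?\<pi> (total_expo k n r c) = 0
        then of_nat (m choose r) * (\<Prod>p=0..l. fact (?N r p)) / ?w c else 0)
      = (if d 0 * r = m then I_coeff k n l d r else 0)" .
  qed
  also have "\<dots> = (\<Sum>r | r \<in> {..m} \<and> d 0 * r = m. I_coeff k n l d r)"
    by (subst sum.inter_filter) auto
  also have "{r. r \<in> {..m} \<and> d 0 * r = m} = {r. d 0 * r = m}"
    using d0(2) by auto
  finally show ?thesis .
qed

theorem proposition54:
  fixes k n l :: nat and d :: "nat \<Rightarrow> nat"
  assumes "k \<ge> 2" and "n \<ge> 2"
    and "\<And>i. i \<in> {1..l} \<Longrightarrow> d i \<ge> 1"
    and "int (d 0) = int k + int n - (\<Sum>i=1..l. int (d i))"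
    and "d 0 > 0"
  shows "constant_terms_series (f_Y k n l d) = I_series k n l d \<and>
         weak_LG_model (variables k n - weight_variables k l d) (n * k - l)
           (I_series k n l d) (f_Y k n l d)"
proof -
  have kn: "k \<ge> 1" "n \<ge> 1" using assms(1,2) by auto
  have "int (u_sum d l + d 0) = int (k + n)"
    using assms(4) by (simp add: u_sum_def)
  then have d0: "u_sum d l + d 0 = k + n" by (simp only: of_nat_eq_iff)
  then have bound: "u_sum d l < k + n" using assms(5) by linarith
  have card: "card (variables k n - weight_variables k l d) = n * k - l"
    by (rule card_reduced_variables[OF assms(3) bound kn])
  have "constant_term (f_Y k n l d ^ m) = (\<Sum>r | d 0 * r = m. I_coeff k n l d r)" for m
    by (rule constant_term_f_Y_power[OF assms(3) kn d0 assms(5)])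
  then have "constant_terms_series (f_Y k n l d) = I_series k n l d"
    by (simp only: constant_terms_series_def I_series_def)
  with card laurent_in_f_Y[OF kn] show ?thesis
    by (simp add: weak_LG_model_def finite_variables)
qed

end
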